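(* Let $H$ be a monoid such that $H = \mathcal{F}(P)\times T$, where $P\subseteq H$ is a set of pairwise non-associated primes and $T\subseteq H$ is a submonoid such that $T_{\mathrm{red}}$ is finitely generated. (1) The set of distances $\Delta(H)$ and the invariants $\rho(H)$, $\omega(H)$, and $\mathsf{t}(H)$ are all finite. (2) $\mathcal{L}(H)$ satisfies the Structure Theorem for Unions.
   Context: $\mathbb{N}$ is the set of positive integers, $\mathbb{N}_0 = \mathbb{N}\cup\{0\}$; $[\![a,b]\!] = \{x \in \mathbb{Z} : a \le x \le b\}$ for $a,b\in\mathbb{R}\cup\{\pm\infty\}$; $\inf\emptyset = \infty$, $\sup\emptyset = 0$. A monoid $H$ is a commutative semigroup with identity that is unit-cancellative: if $a,u \in H$ and $a = au$, then $u \in H^\times$, where $H^\times$ is the group of invertible elements. Elements $a,b$ are associated ($a\simeq b$) if $aH^\times = bH^\times$; $H_{\mathrm{red}} = H/\!\simeq$. A non-unit $p$ is an atom if $p = ab$ implies $a \in H^\times$ or $b \in H^\times$, and is prime if $p\mid ab$ implies $p\mid a$ or $p\mid b$; $\mathcal{A}(H)$ is the set of atoms. $H$ is atomic if every non-unit is a finite product of atoms. $\mathcal{F}(P)$ denotes the free abelian monoid with basis $P$; $H=\mathcal{F}(P)\times T$ means that $H$ is the (internal) direct product of the submonoid generated by $P$, which is free abelian with basis $P$, and $T$. For an atomic $H$ and a non-unit $a$, $\mathsf{L}(a) \subseteq \mathbb{N}$ is the set of all $k$ such that $a$ is a product of $k$ atoms; $\mathsf{L}(a) = \{0\}$ for $a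 \in H^\times$. $\mathcal{L}(H) = \{\mathsf{L}(a) : a \in H\}$. For $L \subseteq \mathbb{N}_0$ put $L^+ = L\cap\mathbb{N}$ and $\rho(L) = \sup L^+/\min L^+$ if $L^+ \ne\emptyset$, else $\rho(L)=1$; $\Delta(L)$ is the set of all $d \in \mathbb{N}$ for which there are $k,\ell\in L$ with $\ell-k=d$ and $L\cap[\![k,\ell]\!]=\{k,\ell\}$. Then $\Delta(H) = \bigcup_{L\in\mathcal{L}(H)}\Delta(L)$, $\rho(H) = \sup\{\rho(L): L\in\mathcal{L}(H)\}$, and for $k\in\mathbb{N}$, $\mathcal{U}_k(H) = \bigcup\{L\in\mathcal{L}(H): k\in L\}$. If $H = H^\times$, one sets $\Delta(H)=\emptyset$, $\rho(H)=1$, $\mathcal{U}_k(H)=\{k\}$. $L \subseteq\mathbb{N}_0$ is an AP with difference $d\in\mathbb{N}$ if $L\ne\emptyset$ and $\Delta(L)\subseteq\{d\}$; it is an AAP with difference $d$ and bound $M\in\mathbb{N}_0$ if $L\subseteq y+d\mathbb{Z}$ for some $y\in\mathbb{Z}$ and $L\cap[\![\inf L+M,\sup L-M]\!]$ is an AP with difference $d$. $\mathcal{L}(H)$ satisfies the Structure Theorem for Unions if there are $d\in\mathbb{N}$, $M\in\mathbb{N}_0$ such that $\mathcal{U}_k(H)$ is an AAP with difference $d$ and bound $M$ for all sufficiently large $k$. $\mathsf{Z}(H)$ is the free abelian monoid with basis $\mathcal{A}(H_{\mathrm{red}})$, $\pi:\mathsf{Z}(H)\to H_{\mathrm{red}}$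 the canonical epimorphism, $\mathsf{Z}(a)=\pi^{-1}(aH^\times)$, and $|z|$ the length of $z\in\mathsf{Z}(H)$. For $z,z'\in\mathsf{Z}(H)$ with $x=\gcd(z,z')$, $z=xy$, $z'=xy'$, put $\mathsf{d}(z,z')=\max\{|y|,|y'|\}$. For $a\in H$, $\omega(H,a)$ is the smallest $N\in\mathbb{N}_0\cup\{\infty\}$ such that whenever $n\in\mathbb{N}$, $a_1,\dots,a_n\in H$ and $a_1\cdots a_n\in aH$, there is $\Omega\subseteq[\![1,n]\!]$ with $|\Omega|\le N$ and $\prod_{\nu\in\Omega}a_\nu\in aH$ (the empty product is $1$); $\omega(H)=\sup\{\omega(H,u):u\in\mathcal{A}(H)\}$. For $u\in\mathcal{A}(H_{\mathrm{red}})$, $\mathsf{t}(H,u)$ is the smallest $N\in\mathbb{N}_0\cup\{\infty\}$ such that for every $a\in H$ with $\mathsf{Z}(a)\cap u\mathsf{Z}(H)\neq\emptyset$ and every $z\in\mathsf{Z}(a)$ there is $z'\in\mathsf{Z}(a)\cap u\mathsf{Z}(H)$ with $\mathsf{d}(z,z')\le N$; $\mathsf{t}(H)=\sup\{\mathsf{t}(H,u):u\in\mathcal{A}(H_{\mathrm{red}})\}$. *)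

theory Defs
  imports
    "HOL-Algebra.Coset"
    "HOL-Algebra.Divisibility"
    "HOL-Algebra.FiniteProduct"
    "HOL-Library.Extended_Nat"
    "HOL-Library.Extended_Nonnegative_Real"
begin

section \<open>Unit-cancellative monoids\<close>

locale unit_cancellative_monoid = comm_monoid G for G (structure) +
  assumes unit_cancel:
    "\<lbrakk>a \<in> carrier G; u \<in> carrier G; a = a \<otimes> u\<rbrakk> \<Longrightarrow> u \<in> Units G"

text \<open>In a commutative monoid the right coset \<open>Units H #> a\<close> is the class \<open>a H\<^sup>\<times>\<close>. The library's
  \<open>associated\<close> is mutual divisibility instead.\<close>

definition unit_assoc :: "('a, 'b) monoid_scheme \<Rightarrow> 'a \<Rightarrow> 'a \<Rightarrow> bool" where
  "unit_assoc H a b \<longleftrightarrow> Units H #>\<^bsub>H\<^esub> a = Units H #>\<^bsub>H\<^esub> b"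

text \<open>The library's quotient \<open>Mod\<close> only uses the multiplication of cosets, so it also makes sense
  for a commutative monoid modulo its group of units.\<close>

definition reduced :: "('a, 'b) monoid_scheme \<Rightarrow> 'a set monoid" where
  "reduced H = H Mod Units H"

definition atoms :: "('a, 'b) monoid_scheme \<Rightarrow> 'a set" where
  "atoms H = {p \<in> carrier H. p \<notin> Units H \<and>
     (\<forall>a\<in>carrier H. \<forall>b\<in>carrier H. p = a \<otimes>\<^bsub>H\<^esub> b \<longrightarrow> a \<in> Units H \<or> b \<in> Units H)}"

definition submonoid_generated :: "('a, 'b) monoid_scheme \<Rightarrow> 'a set \<Rightarrow> 'a set" where
  "submonoid_generated H E = \<Inter>{S. submonoid S H \<and> E \<subseteq> S}"

definition finitely_generated_monoid :: "('a, 'b) monoid_scheme \<Rightarrow> bool" where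
  "finitely_generated_monoid H \<longleftrightarrow>
     (\<exists>E. finite E \<and> E \<subseteq> carrier H \<and> submonoid_generated H E = carrier H)"

text \<open>The free abelian monoid with basis \<open>P\<close> is realised by the finite multisets over \<open>P\<close>.\<close>

definition free_abelian_monoid :: "'a set \<Rightarrow> 'a multiset set" where
  "free_abelian_monoid P = {z. set_mset z \<subseteq> P}"

definition mset_prod :: "('a, 'b) monoid_scheme \<Rightarrow> 'a multiset \<Rightarrow> 'a" where
  "mset_prod H z = (\<Otimes>\<^bsub>H\<^esub>p\<in>set_mset z. p [^]\<^bsub>H\<^esub> count z p)"

definition free_abelian_with_basis :: "('a, 'b) monoid_scheme \<Rightarrow> 'a set \<Rightarrow> bool" where
  "free_abelian_with_basis H P \<longleftrightarrow>
     P \<subseteq> carrier H \<and> bij_betw (mset_prod H) (free_abelian_monoid P) (carrier H)"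

definition internal_direct_product ::
    "('a, 'b) monoid_scheme \<Rightarrow> 'a set \<Rightarrow> 'a set \<Rightarrow> bool" where
  "internal_direct_product H A B \<longleftrightarrow> submonoid A H \<and> submonoid B H \<and>
     (\<lambda>(a, b). a \<otimes>\<^bsub>H\<^esub> b) \<in> iso (H\<lparr>carrier := A\<rparr> \<times>\<times> H\<lparr>carrier := B\<rparr>) H"

text \<open>\<open>H = \<F>(P) \<times> T\<close>\<close>

definition free_times :: "('a, 'b) monoid_scheme \<Rightarrow> 'a set \<Rightarrow> 'a set \<Rightarrow> bool" where
  "free_times H P T \<longleftrightarrow>
     free_abelian_with_basis (H\<lparr>carrier := submonoid_generated H P\<rparr>) P \<and>
     internal_direct_product H (submonoid_generated H P) T"


section \<open>Sets of lengths\<close>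

definition length_set :: "('a, 'b) monoid_scheme \<Rightarrow> 'a \<Rightarrow> nat set" where
  "length_set H a = (if a \<in> Units H then {0}
     else {k. \<exists>as. length as = k \<and> set as \<subseteq> atoms H \<and> foldr (\<otimes>\<^bsub>H\<^esub>) as \<one>\<^bsub>H\<^esub> = a})"

definition length_system :: "('a, 'b) monoid_scheme \<Rightarrow> nat set set" where
  "length_system H = length_set H ` carrier H"

definition set_elasticity :: "nat set \<Rightarrow> ennreal" where
  "set_elasticity L = (let Lp = L - {0} in
     if Lp = {} then 1 else (SUP k\<in>Lp. of_nat k) / of_nat (LEAST k. k \<in> Lp))"

definition set_distances :: "nat set \<Rightarrow> nat set" where
  "set_distances L = {d. d > 0 \<and> (\<exists>k\<in>L. \<exists>l\<in>L. l = k + d \<and> L \<inter> {k..l} = {k, l})}"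

text \<open>If \<open>H\<close> is a group then \<open>length_system H = {{0}}\<close>, and the next two definitions give \<open>{}\<close>
  and \<open>1\<close>; only for the unions does this case have to be treated separately.\<close>

definition distances :: "('a, 'b) monoid_scheme \<Rightarrow> nat set" where
  "distances H = (\<Union>L\<in>length_system H. set_distances L)"

definition elasticity :: "('a, 'b) monoid_scheme \<Rightarrow> ennreal" where
  "elasticity H = (SUP L\<in>length_system H. set_elasticity L)"

definition length_unions :: "('a, 'b) monoid_scheme \<Rightarrow> nat \<Rightarrow> nat set" where
  "length_unions H k =
     (if carrier H = Units H then {k} else \<Union>{L \<in> length_system H. k \<in> L})"

definition is_AP :: "nat \<Rightarrow> nat set \<Rightarrow> bool" where
  "is_AP d L \<longleftrightarrow> L \<noteq> {} \<and> set_distances L \<subseteq> {d}"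

text \<open>The interval bounds are taken in the extended reals, since \<open>sup L\<close> may be infinite and
  \<open>sup L - M\<close> may be negative.\<close>

definition is_AAP :: "nat \<Rightarrow> nat \<Rightarrow> nat set \<Rightarrow> bool" where
  "is_AAP d M L \<longleftrightarrow>
     (\<exists>y::int. int ` L \<subseteq> range (\<lambda>q::int. y + int d * q)) \<and>
     is_AP d {x \<in> L. (INF l\<in>L. ereal (real l)) + ereal (real M) \<le> ereal (real x) \<and>
                     ereal (real x) \<le> (SUP l\<in>L. ereal (real l)) - ereal (real M)}"

definition structure_theorem_for_unions :: "('a, 'b) monoid_scheme \<Rightarrow> bool" where
  "structure_theorem_for_unions H \<longleftrightarrow>
     (\<exists>d>0. \<exists>M. \<forall>\<^sub>F k in sequentially. is_AAP d M (length_unions H k))"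


section \<open>Factorizations, omega invariant and tame degree\<close>

definition factorization_monoid :: "('a, 'b) monoid_scheme \<Rightarrow> 'a set multiset set" where
  "factorization_monoid H = free_abelian_monoid (atoms (reduced H))"

definition factorizations :: "('a, 'b) monoid_scheme \<Rightarrow> 'a \<Rightarrow> 'a set multiset set" where
  "factorizations H a =
     {z \<in> factorization_monoid H. mset_prod (reduced H) z = Units H #>\<^bsub>H\<^esub> a}"

definition factorization_dist :: "'a multiset \<Rightarrow> 'a multiset \<Rightarrow> nat" where
  "factorization_dist z z' = (let x = z \<inter># z' in max (size (z - x)) (size (z' - x)))"

definition omega_elem :: "('a, 'b) monoid_scheme \<Rightarrow> 'a \<Rightarrow> enat" where
  "omega_elem H a = (LEAST N::enat. \<forall>n::nat. \<forall>f. n \<ge> 1 \<longrightarrow> f \<in> {1..n} \<rightarrow> carrier H \<longrightarrow>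
     (\<Otimes>\<^bsub>H\<^esub>i\<in>{1..n}. f i) \<in> a <#\<^bsub>H\<^esub> carrier H \<longrightarrow>
     (\<exists>\<Omega>\<subseteq>{1..n}. enat (card \<Omega>) \<le> N \<and> (\<Otimes>\<^bsub>H\<^esub>i\<in>\<Omega>. f i) \<in> a <#\<^bsub>H\<^esub> carrier H))"

definition omega :: "('a, 'b) monoid_scheme \<Rightarrow> enat" where
  "omega H = (SUP u\<in>atoms H. omega_elem H u)"

definition tame_degree_elem :: "('a, 'b) monoid_scheme \<Rightarrow> 'a set \<Rightarrow> enat" where
  "tame_degree_elem H u = (let uZ = add_mset u ` factorization_monoid H in
     LEAST N::enat. \<forall>a\<in>carrier H. factorizations H a \<inter> uZ \<noteq> {} \<longrightarrow>
       (\<forall>z\<in>factorizations H a. \<exists>z'\<in>factorizations H a \<inter> uZ.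
          enat (factorization_dist z z') \<le> N))"

definition tame_degree :: "('a, 'b) monoid_scheme \<Rightarrow> enat" where
  "tame_degree H = (SUP u\<in>atoms (reduced H). tame_degree_elem H u)"

end

theory Submission
  imports Defs
begin

text \<open>Modulo units, \<open>T\<close> is finitely generated and unit-cancellative, so a minimal generating set \<open>E\<close>
  consists of atoms. Two factorizations of the same element of \<open>H\<close> have the same prime part, and
  their parts over the finite set \<open>E\<close> have the same product. So all invariants are governed by a
  congruence \<open>\<approx>\<close> on the multisets over \<open>E\<close>, to which Dickson's lemma applies. As \<open>H\<close> need not be
  cancellative, \<open>\<approx>\<close> need not be generated by its minimal pairs, but its cancellative closure is: a
  minimal pair \<open>(m, m')\<close> of maximal ratio \<open>|m'| / |m|\<close> bounds the elasticity, and since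
  \<open>x + m \<approx> x + m'\<close> for some \<open>x\<close>, the factorizations \<open>x + n m \<approx> x + n m'\<close> attain this ratio up to
  a bounded error. Combined with a pair whose lengths differ by the generator \<open>d\<close> of the group of
  length differences, they give arithmetic progressions with difference \<open>d\<close> that fill the unions of
  sets of lengths up to a bounded distance from both ends.\<close>

section \<open>Dickson's lemma for multisets\<close>

text \<open>In the congruence, unit-cancellativity takes the form that
  \<open>z + y \<approx> z\<close> implies \<open>y = {#}\<close>, which keeps the ratios of the
  minimal pairs finite and positive. The common summand in \<open>x + m \<approx> x + m'\<close>
  cannot be divided out, so \<open>x\<close> is carried along as a catalyst; it contributes to the
  bounded error at both ends of the unions. One extremal pair serves both ends: as
  \<open>\<approx>\<close> is symmetric, the maximal ratio also bounds lengths from below, so when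
  lengths vary, the maximum of the union for \<open>k\<close> lies near \<open>k |m'| / |m|\<close>
  and its minimum near \<open>k |m| / |m'|\<close>. Exchanges of \<open>m\<close> for
  \<open>m'\<close> approach the first, the reverse exchanges the second. As
  \<open>|m'| - |m| = d q\<close>, fewer than \<open>q\<close> exchanges of a pair with length
  difference \<open>d\<close> fill each interval between consecutive steps. The omega invariant and
  the tame degree rest on a division statement instead: an atom dividing the product of
  \<open>z\<close> already divides the product of a sub-multiset of bounded size, with a cofactor
  that has a factorization of bounded size.\<close>

lemma nat_seq_mono_subseq:
  fixes g :: "nat \<Rightarrow> nat"
  obtains s :: "nat \<Rightarrow> nat" where "strict_mono s" "\<And>m n. m \<le> n \<Longrightarrow> g (s m) \<le> g (s n)"
proof -
  obtain s :: "nat \<Rightarrow> nat" where s: "strict_mono s" "monoseq (\<lambda>n. g (s n))"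
    using seq_monosub by blast
  show ?thesis
  proof (cases "\<forall>m n. m \<le> n \<longrightarrow> g (s m) \<le> g (s n)")
    case True
    then show ?thesis using s that by blast
  next
    case False
    then have dec: "g (s n) \<le> g (s m)" if "m \<le> n" for m n
      using s(2) that unfolding monoseq_def by blast
    \<comment> \<open>A nonincreasing sequence of naturals is constant once it attains its minimum,
      so its tail from \<open>N\<close> on is also nondecreasing.\<close>
    obtain N where N: "g (s N) \<le> g (s n)" for n
      using ex_has_least_nat[of "\<lambda>_. True" 0 "\<lambda>n. g (s n)"] by auto
    show ?thesis
    proof
      show "strict_mono (\<lambda>n. s (N + n))"
        using s(1) by (auto simp: strict_mono_def)
      show "g (s (N + m)) \<le> g (s (N + n))" if "m \<le> n" for m n
        using dec[of N "N + m"] N[of "N + n"] by simp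
    qed
  qed
qed

text \<open>Subsequences are refined for one element of \<open>E\<close> at a time; refining
  preserves the monotonicity already reached for the earlier ones.\<close>

lemma multiset_seq_mono_subseq:
  fixes f :: "nat \<Rightarrow> 'a multiset"
  assumes "finite E" and sub: "\<And>n. set_mset (f n) \<subseteq> E"
  obtains r :: "nat \<Rightarrow> nat" where "strict_mono r" "\<And>m n. m \<le> n \<Longrightarrow> f (r m) \<subseteq># f (r n)"
proof -
  have "\<exists>r :: nat \<Rightarrow> nat. strict_mono r \<and> (\<forall>e\<in>E. \<forall>m n. m \<le> n \<longrightarrow> count (f (r m)) e \<le> count (f (r n)) e)"
    using \<open>finite E\<close>
  proof (induction E)
    case empty
    show ?case by (auto intro: exI[of _ id] strict_mono_id)
  next
    case (insert e E)
    then obtain r :: "nat \<Rightarrow> nat" where r: "strict_mono r"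
      "\<forall>e\<in>E. \<forall>m n. m \<le> n \<longrightarrow> count (f (r m)) e \<le> count (f (r n)) e" by blast
    obtain s :: "nat \<Rightarrow> nat" where s: "strict_mono s"
      "\<And>m n. m \<le> n \<Longrightarrow> count (f (r (s m))) e \<le> count (f (r (s n))) e"
      using nat_seq_mono_subseq[of "\<lambda>n. count (f (r n)) e"] by blast
    have "strict_mono (\<lambda>n. r (s n))" using r(1) s(1) by (simp add: strict_mono_def)
    moreover have "s m \<le> s n" if "m \<le> n" for m n
      using s(1) that by (simp add: strict_mono_less_eq)
    ultimately show ?case
      using r(2) s(2) by (intro exI[of _ "\<lambda>n. r (s n)"]) auto
  qed
  then obtain r :: "nat \<Rightarrow> nat" where r: "strict_mono r"
    "\<And>e m n. e \<in> E \<Longrightarrow> m \<le> n \<Longrightarrow> count (f (r m)) e \<le> count (f (r n)) e" by blast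
  have "f (r m) \<subseteq># f (r n)" if "m \<le> n" for m n
  proof (rule mset_subset_eqI)
    fix e
    show "count (f (r m)) e \<le> count (f (r n)) e"
    proof (cases "e \<in> E")
      case False
      then have "e \<notin># f (r m)" using sub by blast
      then show ?thesis by (simp add: not_in_iff)
    qed (rule r(2)[OF _ that])
  qed
  with r(1) that show ?thesis by blast
qed

lemma multiset_pair_seq_mono_subseq:
  fixes f g :: "nat \<Rightarrow> 'a multiset"
  assumes "finite E" "\<And>n. set_mset (f n) \<subseteq> E" "\<And>n. set_mset (g n) \<subseteq> E"
  obtains r :: "nat \<Rightarrow> nat" where "strict_mono r" "\<And>m n. m \<le> n \<Longrightarrow> f (r m) \<subseteq># f (r n)"
    "\<And>m n. m \<le> n \<Longrightarrow> g (r m) \<subseteq># g (r n)"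
proof -
  obtain r :: "nat \<Rightarrow> nat" where r: "strict_mono r" "\<And>m n. m \<le> n \<Longrightarrow> f (r m) \<subseteq># f (r n)"
    using multiset_seq_mono_subseq[of E f] assms by blast
  obtain s :: "nat \<Rightarrow> nat" where s: "strict_mono s" "\<And>m n. m \<le> n \<Longrightarrow> g (r (s m)) \<subseteq># g (r (s n))"
    using multiset_seq_mono_subseq[of E "\<lambda>n. g (r n)"] assms by blast
  have "strict_mono (\<lambda>n. r (s n))" using r(1) s(1) by (simp add: strict_mono_def)
  moreover have "f (r (s m)) \<subseteq># f (r (s n))" if "m \<le> n" for m n
    using r(2) s(1) that by (simp add: strict_mono_less_eq)
  ultimately show ?thesis using s(2) that by blast
qed

definition pair_le :: "'a multiset \<times> 'a multiset \<Rightarrow> 'a multiset \<times> 'a multiset \<Rightarrow> bool" where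
  "pair_le x y \<longleftrightarrow> fst x \<subseteq># fst y \<and> snd x \<subseteq># snd y"

text \<open>The basis is the set of minimal pairs. Infinitely many of them would contain two
  distinct comparable ones, and descent from any pair stops because the total size drops.\<close>

lemma multiset_pair_finite_basis:
  assumes "finite E" and sub: "\<And>x y. (x, y) \<in> X \<Longrightarrow> set_mset x \<subseteq> E \<and> set_mset y \<subseteq> E"
  obtains B where "finite B" "B \<subseteq> X" "\<And>x. x \<in> X \<Longrightarrow> \<exists>b\<in>B. pair_le b x"
proof -
  define B where "B = {x \<in> X. \<forall>y\<in>X. pair_le y x \<longrightarrow> y = x}"
  have "finite B"
  proof (rule ccontr)
    assume "infinite B"
    then obtain h :: "nat \<Rightarrow> _" where h: "inj h" "range h \<subseteq> B"
      using infinite_countable_subset by blast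
    have "set_mset (fst (h n)) \<subseteq> E" "set_mset (snd (h n)) \<subseteq> E" for n
      using h(2) sub[of "fst (h n)" "snd (h n)"] by (auto simp: B_def)
    then obtain r :: "nat \<Rightarrow> nat" where r: "strict_mono r" "\<And>m n. m \<le> n \<Longrightarrow> fst (h (r m)) \<subseteq># fst (h (r n))"
      "\<And>m n. m \<le> n \<Longrightarrow> snd (h (r m)) \<subseteq># snd (h (r n))"
      using multiset_pair_seq_mono_subseq[OF \<open>finite E\<close>, of "\<lambda>n. fst (h n)" "\<lambda>n. snd (h n)"] by blast
    have "pair_le (h (r 0)) (h (r 1))" using r(2,3)[of 0 1] by (simp add: pair_le_def)
    moreover have "h (r 0) \<in> B" "h (r 1) \<in> B" using h(2) by auto
    ultimately have "h (r 0) = h (r 1)" by (simp add: B_def)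
    then have "r 0 = r 1" using h(1) by (simp add: inj_eq)
    then show False using r(1) by (simp add: strict_mono_eq)
  qed
  moreover have "\<exists>b\<in>B. pair_le b x" if "x \<in> X" for x
    using that
  proof (induction "size (fst x) + size (snd x)" arbitrary: x rule: less_induct)
    case less
    show ?case
    proof (cases "x \<in> B")
      case True
      then show ?thesis by (auto simp: pair_le_def)
    next
      case False
      then obtain y where y: "y \<in> X" "pair_le y x" "y \<noteq> x" using less.prems by (auto simp: B_def)
      then have "fst y \<subset># fst x \<or> snd y \<subset># snd x"
        by (auto simp: pair_le_def prod_eq_iff subset_mset.less_le)
      then have "size (fst y) + size (snd y) < size (fst x) + size (snd x)"
        using y(2) by (auto simp: pair_le_def mset_subset_size size_mset_mono
            intro: add_less_le_mono add_le_less_mono)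
      then obtain b where "b \<in> B" "pair_le b y" using less.hyps y(1) by blast
      then show ?thesis using y(2) by (meson pair_le_def subset_mset.order_trans)
    qed
  qed
  ultimately show ?thesis using that[of B] by (auto simp: B_def)
qed

lemma multiset_finite_basis:
  fixes X :: "'a multiset set"
  assumes "finite E" "\<And>x. x \<in> X \<Longrightarrow> set_mset x \<subseteq> E"
  obtains B where "finite B" "B \<subseteq> X" "\<And>x. x \<in> X \<Longrightarrow> \<exists>b\<in>B. b \<subseteq># x"
proof -
  have sub: "set_mset x \<subseteq> E \<and> set_mset y \<subseteq> E" if "(x, y) \<in> (\<lambda>x. (x, {#})) ` X" for x y
    using assms(2) that by auto
  obtain B where B: "finite B" "B \<subseteq> (\<lambda>x. (x, {#})) ` X"
    "\<And>x. x \<in> (\<lambda>x. (x, {#})) ` X \<Longrightarrow> \<exists>b\<in>B. pair_le b x"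
    using multiset_pair_finite_basis[OF \<open>finite E\<close> sub] by blast
  show ?thesis
  proof
    show "finite (fst ` B)" "fst ` B \<subseteq> X" using B by auto
    show "\<exists>b\<in>fst ` B. b \<subseteq># x" if "x \<in> X" for x
      using B(3)[of "(x, {#})"] that by (force simp: pair_le_def)
  qed
qed

section \<open>Congruences of free abelian monoids\<close>

text \<open>Models equality of products for factorizations over the atoms \<open>A\<close> of a reduced
  unit-cancellative monoid, in which the atoms outside \<open>E\<close> generate a free factor.\<close>

locale almost_free_congruence =
  fixes A E :: "'a set" and sim :: "'a multiset \<Rightarrow> 'a multiset \<Rightarrow> bool" (infix "\<approx>" 50)
  assumes finite_E: "finite E" and E_subset: "E \<subseteq> A"
    and sim_dom: "z \<approx> z' \<Longrightarrow> set_mset z \<subseteq> A"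
    and sim_refl: "set_mset z \<subseteq> A \<Longrightarrow> z \<approx> z"
    and sim_sym: "z \<approx> z' \<Longrightarrow> z' \<approx> z"
    and sim_trans [trans]: "z \<approx> z' \<Longrightarrow> z' \<approx> z'' \<Longrightarrow> z \<approx> z''"
    and sim_add: "z \<approx> z' \<Longrightarrow> set_mset w \<subseteq> A \<Longrightarrow> z + w \<approx> z' + w"
    and sim_cancel: "z + y \<approx> z \<Longrightarrow> y = {#}"
    and sim_free_part: "z \<approx> z' \<Longrightarrow> filter_mset (\<lambda>x. x \<notin> E) z = filter_mset (\<lambda>x. x \<notin> E) z'"
    and sim_finite_part: "z \<approx> z' \<Longrightarrow> filter_mset (\<lambda>x. x \<in> E) z \<approx> filter_mset (\<lambda>x. x \<in> E) z'"
begin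

abbreviation free_part where "free_part z \<equiv> filter_mset (\<lambda>x. x \<notin> E) z"
abbreviation finite_part where "finite_part z \<equiv> filter_mset (\<lambda>x. x \<in> E) z"

lemma parts: "finite_part z + free_part z = z"
  by (rule multiset_partition[symmetric])

lemma size_parts: "size (finite_part z) + size (free_part z) = size z"
  by (metis parts size_union)

lemma sim_dom2: "z \<approx> z' \<Longrightarrow> set_mset z' \<subseteq> A"
  using sim_sym sim_dom by blast

lemma sim_add_sim:
  assumes "z \<approx> z'" "w \<approx> w'"
  shows "z + w \<approx> z' + w'"
proof -
  have "z + w \<approx> z' + w" using assms sim_add sim_dom by blast
  also have "z' + w \<approx> z' + w'" using sim_add[OF assms(2) sim_dom2[OF assms(1)]] by (simp add: add.commute)
  finally show ?thesis .
qed

text \<open>The catalyst \<open>x\<close> is not consumed by an exchange, and the other copies act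
  as added context. Hence a single \<open>x\<close> serves any number of exchanges.\<close>

lemma sim_repeat:
  assumes "x + m \<approx> x + m'"
  shows "x + repeat_mset n m \<approx> x + repeat_mset n m'"
proof (induction n)
  case 0
  show ?case using sim_dom[OF assms] by (simp add: sim_refl)
next
  case (Suc n)
  have d: "set_mset m \<subseteq> A" "set_mset m' \<subseteq> A" using sim_dom[OF assms] sim_dom2[OF assms] by auto
  have sub: "set_mset (repeat_mset n m') \<subseteq> A" using d by (auto simp flip: count_greater_zero_iff)
  have "x + repeat_mset (Suc n) m = (x + repeat_mset n m) + m" by (simp add: ac_simps)
  also have "\<dots> \<approx> (x + repeat_mset n m') + m" using Suc d sim_add by blast
  also have "\<dots> = (x + m) + repeat_mset n m'" by (simp add: ac_simps)
  also have "\<dots> \<approx> (x + m') + repeat_mset n m'" using sim_add[OF assms sub] .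
  also have "\<dots> = x + repeat_mset (Suc n) m'" by (simp add: ac_simps)
  finally show ?case .
qed

text \<open>If a gap pair \<open>(x, y)\<close> is dominated by a longer gap pair \<open>(x + a, y + b)\<close>, then the length
  of \<open>x + b\<close> is strictly between those of \<open>x + a\<close> and \<open>y + b\<close>, so by Dickson's lemma gaps are bounded.\<close>

lemma bounded_gaps:
  obtains N where "\<And>z z'. \<lbrakk>z \<approx> z'; size z < size z';
    \<And>y. y \<approx> z \<Longrightarrow> \<not> (size z < size y \<and> size y < size z')\<rbrakk> \<Longrightarrow> size z' - size z \<le> N"
proof -
  define gap where "gap z z' \<longleftrightarrow> z \<approx> z' \<and> size z < size z' \<and>
    (\<forall>y. y \<approx> z \<longrightarrow> \<not> (size z < size y \<and> size y < size z'))" for z z'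
  have "\<exists>N. \<forall>z z'. gap z z' \<longrightarrow> size z' - size z \<le> N"
  proof (rule ccontr)
    assume "\<not> ?thesis"
    then have "\<forall>N. \<exists>z z'. gap z z' \<and> size z' - size z > N" by (meson not_le)
    then obtain f g where fg: "\<And>n. gap (f n) (g n)" "\<And>n. size (g n) - size (f n) > n" by metis
    have sim: "f n \<approx> g n" for n using fg(1) by (simp add: gap_def)
    obtain r :: "nat \<Rightarrow> nat" where r: "strict_mono r" "\<And>m n. m \<le> n \<Longrightarrow> finite_part (f (r m)) \<subseteq># finite_part (f (r n))"
      "\<And>m n. m \<le> n \<Longrightarrow> finite_part (g (r m)) \<subseteq># finite_part (g (r n))"
      using multiset_pair_seq_mono_subseq[OF finite_E, of "\<lambda>n. finite_part (f n)" "\<lambda>n. finite_part (g n)"]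
      by (auto simp: subset_iff)
    \<comment> \<open>The \<open>n\<close>-th gap exceeds \<open>n\<close>, and
      \<open>r k \<ge> k\<close>; so this index gives a pair whose finite parts dominate those of
      the first pair and whose gap is strictly larger.\<close>
    define n where "n = r (size (g (r 0)) - size (f (r 0)))"
    have n: "size (g (r 0)) - size (f (r 0)) < size (g n) - size (f n)"
      using fg(2)[of n] seq_suble[OF r(1), of "size (g (r 0)) - size (f (r 0))"] unfolding n_def
      by linarith
    \<comment> \<open>Congruent multisets have equal free parts, so \<open>size y - size x\<close>
      is still the full gap of the first pair.\<close>
    define x y where "x = finite_part (f (r 0))" and "y = finite_part (g (r 0))"
    define b where "b = finite_part (g n) - y"
    have xy: "x \<approx> y" using sim_finite_part[OF sim] by (simp add: x_def y_def)
    have yb: "finite_part (g n) = y + b"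
      using r(3)[of 0 "size (g (r 0)) - size (f (r 0))"] by (simp add: b_def y_def n_def)
    have dg: "set_mset (g n) \<subseteq> A" using sim sim_dom2 by blast
    have gn: "g n = y + (b + free_part (g n))" by (metis parts yb add.assoc)
    have "set_mset (b + free_part (g n)) \<subseteq> A" using dg gn by (metis set_mset_union le_sup_iff)
    then have "x + (b + free_part (g n)) \<approx> g n" using sim_add[OF xy] gn by metis
    then have *: "x + (b + free_part (g n)) \<approx> f n" using sim sim_sym sim_trans by blast
    have "size x + size (free_part (f (r 0))) = size (f (r 0))"
      "size y + size (free_part (f (r 0))) = size (g (r 0))"
      using size_parts[of "f (r 0)"] size_parts[of "g (r 0)"] sim_free_part[OF sim[of "r 0"]]
      by (auto simp: x_def y_def)
    moreover have "size (g n) = size y + size (b + free_part (g n))" by (metis gn size_union)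
    moreover have "size (f (r 0)) < size (g (r 0))" "size (f n) < size (g n)"
      using fg(1) by (auto simp: gap_def)
    ultimately have "size (f n) < size (x + (b + free_part (g n)))"
      "size (x + (b + free_part (g n))) < size (g n)"
      using n by auto
    then show False using * fg(1)[of n] unfolding gap_def by blast
  qed
  then show ?thesis using that unfolding gap_def by blast
qed

text \<open>The cancellative closure of \<open>\<approx>\<close> is generated by its minimal elements, and these have
  two nonempty components by unit-cancellativity.\<close>

lemma extremal_ratio:
  assumes "E \<noteq> {}"
  obtains x m m' where "x + m \<approx> x + m'" "0 < size m" "size m \<le> size m'"
    "\<And>z z'. z \<approx> z' \<Longrightarrow> size z' * size m \<le> size m' * size z"
proof -
  define R where "R = {(z, z'). set_mset z \<subseteq> E \<and> set_mset z' \<subseteq> E \<and>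
    (\<exists>x. set_mset x \<subseteq> A \<and> x + z \<approx> x + z')}"
  have sym: "(z', z) \<in> R" if "(z, z') \<in> R" for z z' using that sim_sym by (auto simp: R_def)
  have nonempty: "z = {#}" if "(z, {#}) \<in> R" for z
    using that sim_cancel by (auto simp: R_def)
  have nonempty': "z = {#}" if "({#}, z) \<in> R" for z
    using that sym nonempty by blast
  \<comment> \<open>Over the catalyst \<open>x + y + b\<close> the smaller pair can be subtracted.
    This closure under subtraction is what the cancellative closure gains over
    \<open>\<approx>\<close>.\<close>
  have diff: "(z - b, z' - b') \<in> R" if zR: "(z, z') \<in> R" and bR: "(b, b') \<in> R"
    and le: "pair_le (b, b') (z, z')" for z z' b b'
  proof -
    obtain x where x: "set_mset x \<subseteq> A" "x + z \<approx> x + z'" using zR by (auto simp: R_def)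
    obtain y where y: "set_mset y \<subseteq> A" "y + b \<approx> y + b'" using bR by (auto simp: R_def)
    have bz: "b + (z - b) = z" "b' + (z' - b') = z'" using le by (auto simp: pair_le_def)
    have dom: "set_mset (z - b) \<subseteq> E" "set_mset (z' - b') \<subseteq> E"
      using zR by (auto simp: R_def dest: in_diffD)
    have dA: "set_mset z' \<subseteq> A" "set_mset b' \<subseteq> A" "set_mset b \<subseteq> A"
      using sim_dom2[OF x(2)] sim_dom2[OF y(2)] sim_dom[OF y(2)] by auto
    have "(x + y + b) + (z - b) = (x + z) + y" using bz by (metis add.assoc add.commute)
    also have "\<dots> \<approx> (x + z') + y" using sim_add[OF x(2) y(1)] .
    also have "\<dots> = (y + b') + (x + (z' - b'))" using bz by (metis add.assoc add.commute)
    also have "\<dots> \<approx> (y + b) + (x + (z' - b'))"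
      using sim_add[OF sim_sym[OF y(2)], of "x + (z' - b')"] x dom(2) E_subset by auto
    also have "\<dots> = (x + y + b) + (z' - b')" by (simp add: ac_simps)
    finally have "(x + y + b) + (z - b) \<approx> (x + y + b) + (z' - b')" .
    moreover have "set_mset (x + y + b) \<subseteq> A" using x y dA by auto
    ultimately show ?thesis using dom unfolding R_def by blast
  qed
  define X where "X = R - {({#}, {#})}"
  have "set_mset z \<subseteq> E \<and> set_mset z' \<subseteq> E" if "(z, z') \<in> X" for z z'
    using that by (simp add: X_def R_def)
  from multiset_pair_finite_basis[OF finite_E this] obtain B
    where B: "finite B" "B \<subseteq> X" "\<And>x. x \<in> X \<Longrightarrow> \<exists>b\<in>B. pair_le b x" by metis
  have pos: "0 < size (fst b)" "0 < size (snd b)" if "b \<in> B" for b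
  proof -
    obtain z z' where b: "b = (z, z')" by (cases b)
    have "(z, z') \<in> R" "z \<noteq> {#} \<or> z' \<noteq> {#}" using that B(2) by (auto simp: X_def b)
    then have "z \<noteq> {#}" "z' \<noteq> {#}" using nonempty nonempty' by blast+
    then show "0 < size (fst b)" "0 < size (snd b)" by (simp_all add: b nonempty_has_size)
  qed
  obtain e where "e \<in> E" using assms by blast
  \<comment> \<open>This trivial pair makes the basis nonempty and later shows that the maximal
    ratio is at least 1.\<close>
  then have e: "({#e#}, {#e#}) \<in> X"
    using E_subset sim_refl[of "{#} + {#e#}"] by (auto simp: X_def R_def intro!: exI[of _ "{#}"])
  then have "B \<noteq> {}" using B(3) by blast
  define q where "q b = real (size (snd b)) / real (size (fst b))" for b :: "'a multiset \<times> 'a multiset"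
  obtain c where c: "c \<in> B" "\<And>b. b \<in> B \<Longrightarrow> q b \<le> q c"
  proof -
    have "Max (q ` B) \<in> q ` B" using B(1) \<open>B \<noteq> {}\<close> by simp
    then obtain c where "c \<in> B" "q c = Max (q ` B)" by auto
    then show ?thesis using that B(1) by (metis Max_ge finite_imageI imageI)
  qed
  obtain m m' where mm: "c = (m, m')" by (cases c)
  have m0: "0 < size m" using pos(1)[OF c(1)] mm by simp
  have basis: "size b' * size m \<le> size m' * size b" if "(b, b') \<in> B" for b b'
  proof -
    have "real (size b') / real (size b) \<le> real (size m') / real (size m)"
      using c(2)[OF that] by (simp add: q_def mm)
    then have "real (size b') * real (size m) \<le> real (size m') * real (size b)"
      using m0 pos[OF that] by (simp add: divide_simps)
    then show ?thesis by (metis of_nat_le_iff of_nat_mult)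
  qed
  \<comment> \<open>The inequality is additive, so it passes from the basis to all of
    \<open>R\<close> by repeated subtraction of basis elements.\<close>
  have ratio: "size z' * size m \<le> size m' * size z" if "(z, z') \<in> R" for z z'
    using that
  proof (induction "size z" arbitrary: z z' rule: less_induct)
    case less
    show ?case
    proof (cases "(z, z') = ({#}, {#})")
      case False
      then obtain b b' where b: "(b, b') \<in> B" "pair_le (b, b') (z, z')"
        using B(3)[of "(z, z')"] less.prems by (auto simp: X_def)
      have bR: "(b, b') \<in> R" using b(1) B(2) by (auto simp: X_def)
      have s: "size z = size b + size (z - b)" "size z' = size b' + size (z' - b')"
        using b(2) by (auto simp: pair_le_def size_Diff_submset size_mset_mono)
      have "size (z' - b') * size m \<le> size m' * size (z - b)"
        using less.hyps[OF _ diff[OF less.prems bR b(2)]] s pos[OF b(1)] by auto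
      then show ?thesis using basis[OF b(1)] s by (simp add: algebra_simps)
    qed simp
  qed
  have cR: "(m, m') \<in> R" using c(1) B(2) mm by (auto simp: X_def)
  then obtain x where x: "x + m \<approx> x + m'" by (auto simp: R_def)
  show ?thesis
  proof
    show "x + m \<approx> x + m'" "0 < size m" by fact+
    have "({#e#}, {#e#}) \<in> R" using e by (simp add: X_def)
    from ratio[OF this] show mm': "size m \<le> size m'" by simp
    show "size z' * size m \<le> size m' * size z" if z: "z \<approx> z'" for z z'
    proof -
      \<comment> \<open>The bound on \<open>R\<close> concerns multisets over \<open>E\<close> only.
        The free parts agree, and for them the inequality reduces to
        \<open>size m \<le> size m'\<close>.\<close>
      have "set_mset (finite_part z) \<subseteq> E" "set_mset (finite_part z') \<subseteq> E" by auto
      moreover have "{#} + finite_part z \<approx> {#} + finite_part z'" using sim_finite_part[OF z] by simp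
      ultimately have "(finite_part z, finite_part z') \<in> R"
        unfolding R_def by (auto intro!: exI[of _ "{#}"])
      from ratio[OF this] have "size (finite_part z') * size m \<le> size m' * size (finite_part z)" .
      moreover have "size (free_part z') * size m \<le> size m' * size (free_part z)"
        using sim_free_part[OF z] mm' by (simp add: mult.commute)
      ultimately show ?thesis
        by (subst size_parts[of z, symmetric], subst size_parts[of z', symmetric])
          (simp add: distrib_left distrib_right)
    qed
  qed
qed

text \<open>For \<open>u\<close> in \<open>E\<close>, the multisets over \<open>E\<close> whose
  product is divisible by \<open>u\<close> have a finite basis, and one cofactor is fixed for each
  basis element. An atom outside \<open>E\<close> can only divide by occurring in \<open>z\<close>.
  This is the common source of the bounds for the omega invariant and the tame degree.\<close>

lemma bounded_division:
  obtains N where "\<And>u w z. add_mset u w \<approx> z \<Longrightarrow>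
    \<exists>m w'. m \<subseteq># z \<and> add_mset u w' \<approx> m \<and> size m \<le> N \<and> size w' \<le> N"
proof -
  have "\<forall>u. \<exists>N. \<forall>w z. add_mset u w \<approx> z \<and> set_mset z \<subseteq> E \<longrightarrow>
    (\<exists>m w'. m \<subseteq># z \<and> add_mset u w' \<approx> m \<and> size m \<le> N \<and> size w' \<le> N)"
  proof
    fix u
    define X where "X = {z. set_mset z \<subseteq> E \<and> (\<exists>w. add_mset u w \<approx> z)}"
    have "set_mset z \<subseteq> E" if "z \<in> X" for z using that by (simp add: X_def)
    from multiset_finite_basis[OF finite_E this] obtain B
      where B: "finite B" "B \<subseteq> X" "\<And>x. x \<in> X \<Longrightarrow> \<exists>b\<in>B. b \<subseteq># x" by metis
    have "\<forall>b\<in>B. \<exists>w. add_mset u w \<approx> b" using B(2) by (auto simp: X_def)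
    then obtain g where g: "\<And>b. b \<in> B \<Longrightarrow> add_mset u (g b) \<approx> b" by metis
    define N where "N = (\<Sum>b\<in>B. size b + size (g b))"
    have N: "size b + size (g b) \<le> N" if "b \<in> B" for b
      unfolding N_def using that B(1) by (intro member_le_sum) auto
    show "\<exists>N. \<forall>w z. add_mset u w \<approx> z \<and> set_mset z \<subseteq> E \<longrightarrow>
    (\<exists>m w'. m \<subseteq># z \<and> add_mset u w' \<approx> m \<and> size m \<le> N \<and> size w' \<le> N)"
    proof (intro exI[of _ N] allI impI)
      fix w z assume "add_mset u w \<approx> z \<and> set_mset z \<subseteq> E"
      then obtain b where "b \<in> B" "b \<subseteq># z" using B(3) by (auto simp: X_def)
      then show "\<exists>m w'. m \<subseteq># z \<and> add_mset u w' \<approx> m \<and> size m \<le> N \<and> size w' \<le> N"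
        using g[of b] N[of b] by (intro exI[of _ b] exI[of _ "g b"]) simp
    qed
  qed
  then obtain K where K: "\<And>u w z. add_mset u w \<approx> z \<Longrightarrow> set_mset z \<subseteq> E \<Longrightarrow>
    \<exists>m w'. m \<subseteq># z \<and> add_mset u w' \<approx> m \<and> size m \<le> K u \<and> size w' \<le> K u"
    unfolding choice_iff by blast
  \<comment> \<open>Finiteness of \<open>E\<close> makes the bound uniform in \<open>u\<close>;
    \<open>Suc\<close> covers the case \<open>m = {#u#}\<close> of an atom outside
    \<open>E\<close>.\<close>
  define N where "N = Suc (\<Sum>u\<in>E. K u)"
  have KN: "K u \<le> N" if "u \<in> E" for u
    using member_le_sum[of u E K] that finite_E by (simp add: N_def)
  show ?thesis
  proof (rule that[of N])
    fix u w z assume uz: "add_mset u w \<approx> z"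
    show "\<exists>m w'. m \<subseteq># z \<and> add_mset u w' \<approx> m \<and> size m \<le> N \<and> size w' \<le> N"
    proof (cases "u \<in> E")
      case True
      have "add_mset u (finite_part w) \<approx> finite_part z" using sim_finite_part[OF uz] True by simp
      then obtain m w' where m: "m \<subseteq># finite_part z" "add_mset u w' \<approx> m" "size m \<le> K u" "size w' \<le> K u"
        using K[of u "finite_part w" "finite_part z"] by auto
      moreover have "m \<subseteq># z" using m(1) multiset_filter_subset subset_mset.order_trans by blast
      ultimately show ?thesis using KN[OF True] by (intro exI[of _ m] exI[of _ w']) simp
    next
      case False
      then have "free_part z = add_mset u (free_part w)" using sim_free_part[OF uz] by simp
      then have "u \<in># free_part z" by simp
      then have "{#u#} \<subseteq># z" by simp
      moreover have "{#u#} \<approx> {#u#}" using sim_dom[OF uz] by (intro sim_refl) auto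
      ultimately show ?thesis by (intro exI[of _ "{#u#}"] exI[of _ "{#}"]) (simp add: N_def)
    qed
  qed
qed

end

section \<open>Unions of sets of lengths\<close>

text \<open>A distance in the central part is a multiple of \<open>d\<close>, and
  \<open>l + d\<close> lies in the central part whenever a larger central element follows
  \<open>l\<close>, so the distance is \<open>d\<close>. The element \<open>k\<close> fixes the
  residue class and makes the central part nonempty. Adding \<open>M\<close> on the smaller side
  avoids truncated subtraction.\<close>

lemma is_AAP_finiteI:
  assumes fin: "finite L" and "0 < d"
    and cong: "\<And>x. x \<in> L \<Longrightarrow> int d dvd int x - int k"
    and k: "k \<in> L" "Min L + M \<le> k" "k + M \<le> Max L"
    and mid: "\<And>x. \<lbrakk>Min L + M \<le> x; x + M \<le> Max L; int d dvd int x - int k\<rbrakk> \<Longrightarrow> x \<in> L"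
  shows "is_AAP d M L"
proof -
  have ne: "L \<noteq> {}" using k(1) by blast
  have inf: "(INF l\<in>L. ereal (real l)) = ereal (real (Min L))"
    using fin ne by (intro antisym INF_lower INF_greatest) auto
  have sup: "(SUP l\<in>L. ereal (real l)) = ereal (real (Max L))"
    using fin ne by (intro antisym SUP_upper SUP_least) auto
  have sup_le: "ereal (real x) \<le> ereal (real (Max L)) - ereal (real M) \<longleftrightarrow> x + M \<le> Max L" for x
    by (simp add: le_diff_eq flip: of_nat_add)
  have inf_le: "ereal (real (Min L)) + ereal (real M) \<le> ereal (real x) \<longleftrightarrow> Min L + M \<le> x" for x
    by (simp flip: of_nat_add)
  define S where "S = {x \<in> L. Min L + M \<le> x \<and> x + M \<le> Max L}"
  have "e = d" if e: "e \<in> set_distances S" for e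
  proof -
    obtain l where l: "0 < e" "l \<in> S" "l + e \<in> S" "S \<inter> {l..l + e} = {l, l + e}"
      using e unfolding set_distances_def by blast
    have lc: "int d dvd int l - int k" "int d dvd int (l + e) - int k"
      using l(2,3) cong[of l] cong[of "l + e"] unfolding S_def by blast+
    then have "int d dvd (int (l + e) - int k) - (int l - int k)" by (rule dvd_diff[rotated])
    then have "d dvd e" by simp
    then have "d \<le> e" using l(1) by (simp add: dvd_imp_le)
    have "int (l + d) - int k = (int l - int k) + int d" by simp
    then have "int d dvd int (l + d) - int k" using lc(1) by (metis dvd_add dvd_refl)
    then have "l + d \<in> S" using mid[of "l + d"] l(2,3) \<open>d \<le> e\<close> by (auto simp: S_def)
    then have "l + d \<in> {l, l + e}" using l(4) \<open>d \<le> e\<close> by (auto simp flip: l(4))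
    then show ?thesis using \<open>0 < d\<close> by auto
  qed
  moreover have "k \<in> S" using k by (simp add: S_def)
  ultimately have "is_AP d S" by (auto simp: is_AP_def)
  moreover have "int x = int k + int d * ((int x - int k) div int d)" if "x \<in> L" for x
    using cong[OF that] by simp
  then have "int ` L \<subseteq> range (\<lambda>q. int k + int d * q)" by blast
  ultimately show ?thesis unfolding is_AAP_def inf sup sup_le inf_le S_def by blast
qed

text \<open>Rounding down the number of blocks of length \<open>a\<close> that fit into
  \<open>k - B\<close> loses less than one block.\<close>

lemma less_div_bracket:
  fixes a B k :: nat
  assumes "0 < a" "B \<le> k"
  shows "k < B + a * (1 + (k - B) div a)"
proof -
  define c where "c = k - B"
  have k: "k = B + c" using assms(2) by (simp add: c_def)
  obtain n r where "c div a = n" "c mod a = r" by simp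
  moreover have "c div a * a + c mod a = c" "c mod a < a" using assms(1) by simp_all
  ultimately show ?thesis by (auto simp: k algebra_simps)
qed

section \<open>Lengths of congruent multisets and the progressions they contain\<close>

context almost_free_congruence
begin

text \<open>For the kernel congruence of the factorization homomorphism of a monoid that is not a
  group, this is the union of all sets of lengths containing \<open>k\<close>.\<close>

definition colengths :: "nat \<Rightarrow> nat set" where
  "colengths k = {l. \<exists>z z'. z \<approx> z' \<and> size z = k \<and> size z' = l}"

text \<open>Congruent pairs can be added and reversed, so their length differences form a group, and
  its least positive element divides all others.\<close>

lemma difference_generator:
  assumes "w \<approx> w'" "size w < size w'"
  obtains d u u' where "0 < d" "u \<approx> u'" "size u' = size u + d"
    "\<And>z z'. z \<approx> z' \<Longrightarrow> int d dvd int (size z') - int (size z)"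
proof -
  define Q where "Q e \<longleftrightarrow> 0 < e \<and> (\<exists>z z'. z \<approx> z' \<and> size z' = size z + e)" for e :: nat
  have "size w' = size w + (size w' - size w)" using assms(2) by simp
  then have "Q (size w' - size w)" using assms unfolding Q_def by (metis zero_less_diff)
  define d where "d = (LEAST e. Q e)"
  have "Q d" using LeastI[of Q] \<open>Q (size w' - size w)\<close> by (simp add: d_def)
  then obtain u u' where u: "0 < d" "u \<approx> u'" "size u' = size u + d" by (auto simp: Q_def)
  have pos: "d dvd e" if "z \<approx> z'" "size z' = size z + e" for z z' e
  proof (rule ccontr)
    assume "\<not> d dvd e"
    then have r: "0 < e mod d" "e mod d < d" using u(1) by (auto simp: dvd_eq_mod_eq_0)
    let ?q = "e div d"
    \<comment> \<open>Each added reversed pair \<open>(u', u)\<close> takes \<open>d\<close> off the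
      difference \<open>e\<close>; after \<open>e div d\<close> of them the remainder is itself a
      smaller positive difference.\<close>
    have "{#} + repeat_mset ?q u' \<approx> {#} + repeat_mset ?q u"
      using sim_repeat[of "{#}" u' u] u(2) sim_sym by simp
    then have "z + repeat_mset ?q u' \<approx> z' + repeat_mset ?q u"
      using sim_add_sim[OF that(1)] by simp
    moreover have "size (z' + repeat_mset ?q u) = size (z + repeat_mset ?q u') + e mod d"
      using that(2) u(3) div_mult_mod_eq[of e d] by (simp add: algebra_simps)
    ultimately have "Q (e mod d)" using r unfolding Q_def by blast
    then show False using r(2) not_less_Least[of "e mod d" Q] by (simp add: d_def)
  qed
  have "int d dvd int (size z') - int (size z)" if z: "z \<approx> z'" for z z'
  proof (cases "size z \<le> size z'")
    case True
    then have "d dvd size z' - size z" using pos[OF z] by simp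
    then show ?thesis using True by (metis int_dvd_int_iff of_nat_diff)
  next
    case False
    then have "d dvd size z - size z'" using pos[OF sim_sym[OF z]] by simp
    then have "int d dvd int (size z) - int (size z')" using False by (metis int_dvd_int_iff of_nat_diff nat_le_linear)
    then show ?thesis by (simp add: dvd_diff_commute)
  qed
  with u that show ?thesis by blast
qed

text \<open>Each exchange of \<open>m\<close> for \<open>m'\<close> adds \<open>d q\<close> to the length and each exchange of \<open>u\<close> for \<open>u'\<close> adds
  \<open>d\<close>, so writing \<open>s = (s div q) q + s mod q\<close> reaches every step of the progression.\<close>

lemma progressions_in_length_sets:
  assumes x: "x + m \<approx> x + m'" and size_m: "size m' = size m + d * q"
    and u: "u \<approx> u'" "size u' = size u + d" and e: "e \<in> A" and q: "0 < q"
    and st: "s \<le> n * q" "t \<le> n * q"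
  shows "size x + q * size u + n * size m + r + d * s \<in>
    colengths (size x + q * size u + n * size m + r + d * t)"
proof -
  \<comment> \<open>There are \<open>n\<close> slots for \<open>m\<close> or \<open>m'\<close>,
    \<open>q\<close> slots for \<open>u\<close> or \<open>u'\<close>, and \<open>r\<close> copies of
    \<open>e\<close> that pad the length. All these multisets are congruent to \<open>z 0\<close>,
    so \<open>t\<close> may be any starting point: \<open>t = 0\<close> is used to go up and
    \<open>t = n * q\<close> to go down.\<close>
  define z where "z s = x + repeat_mset (s div q) m' + repeat_mset (n - s div q) m +
    (repeat_mset (s mod q) u' + repeat_mset (q - s mod q) u) + replicate_mset r e" for s
  have d: "set_mset m \<subseteq> A" "set_mset u \<subseteq> A" using sim_dom[OF x] sim_dom[OF u(1)] by auto
  then have dr: "set_mset (repeat_mset j m) \<subseteq> A" "set_mset (repeat_mset j u) \<subseteq> A" for j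
    by (auto simp flip: count_greater_zero_iff)
  have z: "z s \<approx> z 0" "size (z s) = size x + q * size u + n * size m + r + d * s" if "s \<le> n * q" for s
  proof -
    define i j where "i = s div q" and "j = s mod q"
    have s: "i * q + j = s" by (simp add: i_def j_def)
    have i: "i \<le> n" unfolding i_def using that q by (metis div_le_mono div_mult_self_is_m)
    have j: "j \<le> q" using q by (simp add: j_def less_imp_le)
    have rep: "repeat_mset k v + repeat_mset (N - k) v = repeat_mset N v" if "k \<le> N"
      for k N and v :: "'a multiset"
      using that by (simp flip: repeat_mset_distrib)
    have "x + repeat_mset i m' + repeat_mset (n - i) m \<approx> x + repeat_mset i m + repeat_mset (n - i) m"
      using sim_add[OF sim_sym[OF sim_repeat[OF x]] dr(1)] .
    also have "\<dots> = x + repeat_mset n m" using rep[OF i] by (simp add: add.assoc)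
    finally have 1: "x + repeat_mset i m' + repeat_mset (n - i) m \<approx> x + repeat_mset n m" .
    have "{#} + repeat_mset j u' + repeat_mset (q - j) u \<approx> {#} + repeat_mset j u + repeat_mset (q - j) u"
      using sim_add[OF sim_repeat[of "{#}" u' u] dr(2)] sim_sym[OF u(1)] by simp
    then have 2: "repeat_mset j u' + repeat_mset (q - j) u \<approx> repeat_mset q u"
      using rep[OF j] by simp
    have "set_mset (replicate_mset r e) \<subseteq> A" using e by auto
    from sim_add[OF sim_add_sim[OF 1 2] this]
    show "z s \<approx> z 0" by (simp add: z_def i_def j_def)
    obtain i' where i': "n = i + i'" using i le_iff_add by blast
    obtain j' where j': "q = j + j'" using j le_iff_add by blast
    have "size (z s) = size x + i * (size m + d * q) + i' * size m + (j * (size u + d) + j' * size u) + r"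
    proof -
      have "n - i = i'" "q - j = j'" using i' j' by linarith+
      then show ?thesis using size_m u(2) by (simp add: z_def flip: i_def j_def)
    qed
    also have "\<dots> = size x + (j + j') * size u + (i + i') * size m + r + d * (i * q + j)"
      by (simp add: algebra_simps)
    also have "i * q + j = s" by (fact s)
    also have "j + j' = q" using j' by simp
    also have "i + i' = n" using i' by simp
    finally show "size (z s) = size x + q * size u + n * size m + r + d * s" .
  qed
  have "z t \<approx> z s" using z(1) st sim_sym sim_trans by blast
  then show ?thesis unfolding colengths_def using z(2) st by blast
qed

text \<open>With \<open>a = |m|\<close>, \<open>b = |m'|\<close> and \<open>D = b - a\<close>, a
  length \<open>k\<close> has room for about \<open>k / a\<close> exchanges upwards and
  \<open>k / b\<close> downwards, each changing the length by \<open>D\<close>. The ratio bounds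
  give \<open>(Max - k) a \<le> D k\<close> and \<open>(k - Min) b \<le> D k\<close>, so what the
  exchanges miss at either end is bounded independently of \<open>k\<close>.\<close>

lemma structure_of_colengths:
  assumes "w \<approx> w'" "size w < size w'"
  obtains d M where "0 < d" "\<forall>\<^sub>F k in sequentially. is_AAP d M (colengths k)"
proof -
  obtain d u u' where d: "0 < d" and u: "u \<approx> u'" "size u' = size u + d"
    and cong: "\<And>z z'. z \<approx> z' \<Longrightarrow> int d dvd int (size z') - int (size z)"
    using difference_generator[OF assms] by metis
  have "E \<noteq> {}"
  proof
    assume "E = {}"
    then show False using sim_free_part[OF assms(1)] assms(2) by simp
  qed
  then obtain x m m' where x: "x + m \<approx> x + m'" "0 < size m" "size m \<le> size m'"
    and ratio: "\<And>z z'. z \<approx> z' \<Longrightarrow> size z' * size m \<le> size m' * size z"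
    using extremal_ratio by metis
  obtain e where e: "e \<in> A" using \<open>E \<noteq> {}\<close> E_subset by blast
  define a b where "a = size m" and "b = size m'"
  \<comment> \<open>If \<open>a\<close> and \<open>b\<close> were equal, the ratio bound would force
    \<open>size w' \<le> size w\<close>.\<close>
  have "a \<noteq> b" using ratio[OF assms(1)] x(2) assms(2) by (auto simp: a_def b_def mult.commute)
  then have ab: "0 < a" "a < b" using x by (auto simp: a_def b_def)
  have "int d dvd int b - int a" using cong[OF x(1)] by (simp add: a_def b_def)
  then have "d dvd b - a" using ab by (metis int_dvd_int_iff less_imp_le of_nat_diff)
  then obtain q where "b - a = d * q" by blast
  then have b: "b = a + d * q" and q: "0 < q" using ab by (auto intro: Nat.gr0I)
  \<comment> \<open>The length of the catalyst \<open>x\<close> and of the \<open>q\<close> slots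
    filled with \<open>u\<close>, which must be set aside before \<open>m\<close> is
    repeated.\<close>
  define B where "B = size x + q * size u"
  have prog: "B + n * a + r + d * s \<in> colengths (B + n * a + r + d * t)"
    if "s \<le> n * q" "t \<le> n * q" for n r s t
    using progressions_in_length_sets[OF x(1) _ u e q that] b unfolding a_def b_def B_def by blast
  have bound: "l * a \<le> b * k" "k * a \<le> b * l" if "l \<in> colengths k" for k l
    using that ratio sim_sym unfolding colengths_def a_def b_def by blast+
  \<comment> \<open>At the start all slots hold \<open>m\<close> and \<open>u\<close>, and
    \<open>(k - B) mod a\<close> copies of \<open>e\<close> make the length exactly
    \<open>k\<close>.\<close>
  have up: "k + d * i \<in> colengths k" if "B \<le> k" "i \<le> (k - B) div a * q" for k i
  proof -
    have "B + (k - B) div a * a + (k - B) mod a = k" using that(1) by (simp add: add.assoc)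
    then show ?thesis using prog[OF that(2), of 0 "(k - B) mod a"] by simp
  qed
  \<comment> \<open>At the start all \<open>(k - B) div b\<close> slots hold \<open>m'\<close>;
    undoing exchanges shortens the factorization.\<close>
  have down: "l \<in> colengths k" if kB: "B \<le> k" "i \<le> (k - B) div b * q" "k = l + d * i" for k l i
  proof -
    define n r where "n = (k - B) div b" and "r = (k - B) mod b"
    have "B + (n * b + r) = k" using that(1) by (simp add: n_def r_def)
    then have k: "B + n * a + r + d * (n * q) = k" by (simp add: b algebra_simps)
    obtain j where j: "n * q = i + j" using kB(2) le_iff_add unfolding n_def by blast
    then have "B + n * a + r + d * j = l" using k that(3) by (simp add: algebra_simps)
    then show ?thesis using prog[of j n "n * q" r] k j by simp
  qed
  define D where "D = d * q"
  have D: "b = a + D" "0 < D" using b d q by (auto simp: D_def)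
  \<comment> \<open>Above this threshold there is room for \<open>1 + B\<close> exchanges in both
    directions, which puts \<open>k\<close> itself at distance at least \<open>D * (1 + B)\<close>
    from both ends.\<close>
  have "is_AAP d (D * (1 + B)) (colengths k)" if k: "B + b * (1 + B) \<le> k" for k
  proof (rule is_AAP_finiteI[OF _ d])
    have Bk: "B \<le> k" using k by simp
    define n n' where "n = (k - B) div a" and "n' = (k - B) div b"
    have n: "k < B + a * (1 + n)" and n': "k < B + b * (1 + n')"
      using less_div_bracket[OF _ Bk] ab by (auto simp: n_def n'_def)
    have "b * (1 + B) < b * (1 + n')" using k n' by linarith
    then have n'B: "1 + B \<le> n'" by simp
    also have "n' \<le> n" unfolding n_def n'_def using ab by (simp add: div_le_mono2)
    finally have nB: "1 + B \<le> n" .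
    have "l \<le> b * k" if "l \<in> colengths k" for l
      using bound(1)[OF that] ab(1) by (metis Suc_leI mult.right_neutral mult_le_mono2 order_trans One_nat_def)
    then show fin: "finite (colengths k)" by (meson finite_nat_set_iff_bounded_le)
    show "int d dvd int l - int k" if "l \<in> colengths k" for l
      using that cong unfolding colengths_def by blast
    show kU: "k \<in> colengths k" using up[OF Bk, of 0] by simp
    have MaxU: "Max (colengths k) \<in> colengths k" and MinU: "Min (colengths k) \<in> colengths k"
      using fin kU by (auto intro: Max_in Min_in)
    have "k + d * ((1 + B) * q) \<in> colengths k"
      using mult_le_mono1[OF nB, of q] unfolding n_def by (rule up[OF Bk])
    then show "k + D * (1 + B) \<le> Max (colengths k)"
      using fin by (simp add: D_def ac_simps)
    have "D * (1 + B) \<le> b * (1 + B)" using D(1) by (intro mult_le_mono1) simp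
    then have Mk: "D * (1 + B) \<le> k" using k by linarith
    have "k - D * (1 + B) \<in> colengths k"
    proof (rule down[OF Bk])
      show "(1 + B) * q \<le> (k - B) div b * q" using mult_le_mono1[OF n'B, of q] unfolding n'_def .
      show "k = k - D * (1 + B) + d * ((1 + B) * q)" using Mk by (simp add: D_def ac_simps)
    qed
    then have "Min (colengths k) \<le> k - D * (1 + B)" using fin by simp
    then show "Min (colengths k) + D * (1 + B) \<le> k" using Mk by linarith
    fix l assume l: "Min (colengths k) + D * (1 + B) \<le> l" "l + D * (1 + B) \<le> Max (colengths k)"
      "int d dvd int l - int k"
    show "l \<in> colengths k"
    proof (cases "k \<le> l")
      case True
      then have "int d dvd int (l - k)" using l(3) by (simp add: of_nat_diff)
      then obtain i where i: "l = k + d * i" using True by (metis dvd_def int_dvd_int_iff le_add_diff_inverse)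
      \<comment> \<open>Otherwise \<open>l\<close> is out of reach of the exchanges, and its
        distance from the maximum pushes the maximum above the ratio bound. In the factor
        \<open>1 + B\<close>, the 1 pays for the rounding in \<open>n\<close>, and \<open>B\<close>
        for the part set aside.\<close>
      have "i \<le> n * q"
      proof (rule ccontr)
        assume "\<not> i \<le> n * q"
        then have "d * (n * q) \<le> d * i" by (intro mult_le_mono2) simp
        then have "D * n \<le> d * i" by (simp add: D_def ac_simps)
        then have "k + D * n + D * (1 + B) \<le> Max (colengths k)" using l(2) i by linarith
        then have "(k + D * n + D * (1 + B)) * a \<le> Max (colengths k) * a" by (rule mult_le_mono1)
        also have "\<dots> \<le> b * k" by (rule bound(1)[OF MaxU])
        finally have "D * (n * a + (1 + B) * a) \<le> D * k" using D(1) by (simp add: algebra_simps)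
        then have "n * a + (1 + B) * a \<le> k" using D(2) by simp
        moreover have "B * 1 \<le> B * a" using ab(1) by (intro mult_le_mono2) simp
        moreover have "k < B + a + n * a" "(1 + B) * a = a + B * a" using n by (simp_all add: algebra_simps)
        ultimately show False by linarith
      qed
      then show ?thesis using up[OF Bk] i by (simp add: n_def)
    next
      case False
      then have "int d dvd int (k - l)" using l(3) by (simp add: of_nat_diff dvd_diff_commute)
      then obtain i where i: "k = l + d * i" using False
        by (metis dvd_def int_dvd_int_iff le_add_diff_inverse nat_le_linear)
      \<comment> \<open>The mirror image at the lower end, with blocks of length \<open>b\<close>
        and the lower ratio bound.\<close>
      have "i \<le> n' * q"
      proof (rule ccontr)
        assume "\<not> i \<le> n' * q"
        then have "d * (n' * q) \<le> d * i" by (intro mult_le_mono2) simp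
        then have "D * n' \<le> d * i" by (simp add: D_def ac_simps)
        then have *: "Min (colengths k) + D * (1 + B) + D * n' \<le> k" using l(1) i by linarith
        have "a * k + b * (D * (1 + B) + D * n') \<le> b * Min (colengths k) + b * (D * (1 + B) + D * n')"
          using bound(2)[OF MinU] by (simp add: mult.commute)
        also have "\<dots> \<le> b * k" using mult_le_mono2[OF *, of b] by (simp add: algebra_simps)
        finally have "D * (b * (1 + B) + b * n') \<le> D * k" using D(1) by (simp add: algebra_simps)
        then have "b * (1 + B) + b * n' \<le> k" using D(2) by simp
        moreover have "1 * B \<le> b * B" using ab by (intro mult_le_mono1) simp
        moreover have "k < B + b + b * n'" "b * (1 + B) = b + b * B" using n' by (simp_all add: algebra_simps)
        ultimately show False by linarith
      qed
      then show ?thesis using down[OF Bk _ i] by (simp add: n'_def)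
    qed
  qed
  then have "\<forall>\<^sub>F k in sequentially. is_AAP d (D * (1 + B)) (colengths k)"
    unfolding eventually_sequentially by blast
  with d that show ?thesis by blast
qed

end

section \<open>Products of multisets\<close>

context comm_monoid
begin

text \<open>Elements outside the support enter with exponent 0. A fixed index set is needed because
  the support may change when an element is added.\<close>

lemma mset_prod_superset:
  assumes "finite S" "set_mset z \<subseteq> S" "S \<subseteq> carrier G"
  shows "mset_prod G z = (\<Otimes>p\<in>S. p [^] count z p)"
  unfolding mset_prod_def using assms
  by (intro finprod_mono_neutral_cong_left) (auto simp: not_in_iff)

lemma mset_prod_empty [simp]: "mset_prod G {#} = \<one>"
  by (simp add: mset_prod_def)

lemma mset_prod_add:
  assumes x: "x \<in> carrier G" and z: "set_mset z \<subseteq> carrier G"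
  shows "mset_prod G (add_mset x z) = x \<otimes> mset_prod G z"
proof -
  define S where "S = set_mset z - {x}"
  have S: "finite S" "x \<notin> S" "S \<subseteq> carrier G" using z by (auto simp: S_def)
  have eq: "(\<Otimes>p\<in>S. p [^] count (add_mset x z) p) = (\<Otimes>p\<in>S. p [^] count z p)"
    using S by (intro finprod_cong') auto
  have "mset_prod G (add_mset x z) = (\<Otimes>p\<in>insert x S. p [^] count (add_mset x z) p)"
    using S x by (intro mset_prod_superset) (auto simp: S_def)
  also have "\<dots> = x [^] count (add_mset x z) x \<otimes> (\<Otimes>p\<in>S. p [^] count z p)"
    using S x by (subst finprod_insert) (auto simp: eq simp del: count_add_mset)
  also have "\<dots> = x \<otimes> (x [^] count z x \<otimes> (\<Otimes>p\<in>S. p [^] count z p))"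
    using S x by (simp add: m_ac Pi_def subset_iff)
  also have "x [^] count z x \<otimes> (\<Otimes>p\<in>S. p [^] count z p) = (\<Otimes>p\<in>insert x S. p [^] count z p)"
    using S x by (subst finprod_insert) auto
  also have "\<dots> = mset_prod G z"
    using S x by (intro mset_prod_superset[symmetric]) (auto simp: S_def)
  finally show ?thesis .
qed

lemma mset_prod_closed [simp, intro]:
  "set_mset z \<subseteq> carrier G \<Longrightarrow> mset_prod G z \<in> carrier G"
  by (induction z) (auto simp: mset_prod_add)

lemma mset_prod_union:
  "set_mset z \<subseteq> carrier G \<Longrightarrow> set_mset w \<subseteq> carrier G \<Longrightarrow>
    mset_prod G (z + w) = mset_prod G z \<otimes> mset_prod G w"
  by (induction z) (auto simp: mset_prod_add m_assoc)

lemma submonoid_comm_monoid: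
  assumes "submonoid S G"
  shows "comm_monoid (G\<lparr>carrier := S\<rparr>)"
proof -
  interpret submonoid S G by fact
  show ?thesis using m_comm m_assoc subset by unfold_locales (auto simp: subset_iff)
qed

text \<open>The carrier enters into \<open>finprod\<close>, so the two products are different terms;
  they agree because they obey the same recursion on \<open>z\<close>.\<close>

lemma mset_prod_submonoid:
  assumes "submonoid S G" "set_mset z \<subseteq> S"
  shows "mset_prod (G\<lparr>carrier := S\<rparr>) z = mset_prod G z" "mset_prod G z \<in> S"
proof -
  interpret S: comm_monoid "G\<lparr>carrier := S\<rparr>" by (rule submonoid_comm_monoid[OF assms(1)])
  interpret submonoid S G by fact
  have "set_mset z \<subseteq> carrier G" using assms(2) subset by blast
  then show "mset_prod (G\<lparr>carrier := S\<rparr>) z = mset_prod G z" using assms(2)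
    by (induction z) (auto simp: mset_prod_add S.mset_prod_add)
  then show "mset_prod G z \<in> S" using S.mset_prod_closed[of z] assms(2) by simp
qed

lemma submonoid_generated_eq:
  assumes "F \<subseteq> carrier G"
  shows "submonoid_generated G F = mset_prod G ` {z. set_mset z \<subseteq> F}"
proof
  have "submonoid (mset_prod G ` {z. set_mset z \<subseteq> F}) G"
  proof
    show "x \<otimes> y \<in> mset_prod G ` {z. set_mset z \<subseteq> F}"
      if "x \<in> mset_prod G ` {z. set_mset z \<subseteq> F}" "y \<in> mset_prod G ` {z. set_mset z \<subseteq> F}" for x y
    proof -
      obtain z w where "set_mset z \<subseteq> F" "x = mset_prod G z" "set_mset w \<subseteq> F" "y = mset_prod G w"
        using \<open>x \<in> _\<close> \<open>y \<in> _\<close> by blast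
      then show ?thesis using assms by (intro image_eqI[of _ _ "z + w"]) (auto simp: mset_prod_union)
    qed
    show "\<one> \<in> mset_prod G ` {z. set_mset z \<subseteq> F}" by (auto intro: image_eqI[of _ _ "{#}"])
  qed (use assms in auto)
  moreover have "f \<in> mset_prod G ` {z. set_mset z \<subseteq> F}" if "f \<in> F" for f
    using that assms by (intro image_eqI[of _ _ "{#f#}"]) (auto simp: mset_prod_add subset_iff)
  ultimately show "submonoid_generated G F \<subseteq> mset_prod G ` {z. set_mset z \<subseteq> F}"
    unfolding submonoid_generated_def by blast
  show "mset_prod G ` {z. set_mset z \<subseteq> F} \<subseteq> submonoid_generated G F"
    unfolding submonoid_generated_def using mset_prod_submonoid(2) by blast
qed

end

section \<open>Reduced monoids\<close>

lemma (in unit_cancellative_monoid) prod_eq_factor_unit: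
  assumes "a \<in> carrier G" "b \<in> carrier G" "c \<in> carrier G" "a = a \<otimes> b \<otimes> c"
  shows "b \<in> Units G"
proof -
  have "b \<otimes> c \<in> Units G" using assms unit_cancel[of a "b \<otimes> c"] by (simp add: m_assoc)
  then show ?thesis using assms unit_factor by blast
qed

locale reduced_monoid = unit_cancellative_monoid +
  assumes Units_eq: "Units G = {\<one>}"
begin

lemma cancel_one: "a \<in> carrier G \<Longrightarrow> u \<in> carrier G \<Longrightarrow> a \<otimes> u = a \<Longrightarrow> u = \<one>"
  using unit_cancel[of a u] Units_eq by auto

lemma prod_eq_one: "a \<in> carrier G \<Longrightarrow> b \<in> carrier G \<Longrightarrow> a \<otimes> b = \<one> \<Longrightarrow> a = \<one>"
  using unit_factor[of a b] Units_eq by auto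

lemma atoms_iff: "p \<in> atoms G \<longleftrightarrow> p \<in> carrier G \<and> p \<noteq> \<one> \<and>
    (\<forall>a\<in>carrier G. \<forall>b\<in>carrier G. p = a \<otimes> b \<longrightarrow> a = \<one> \<or> b = \<one>)"
  by (auto simp: atoms_def Units_eq)

lemma mset_prod_eq_one:
  assumes "set_mset z \<subseteq> carrier G - {\<one>}" "mset_prod G z = \<one>"
  shows "z = {#}"
proof (cases z)
  case (add x z')
  then have x: "x \<in> carrier G" "set_mset z' \<subseteq> carrier G" "x \<noteq> \<one>" using assms(1) by auto
  then have "x \<otimes> mset_prod G z' = \<one>" "mset_prod G z' \<in> carrier G"
    using assms(2) add mset_prod_add[of x z'] by auto
  with x show ?thesis using prod_eq_one by blast
qed

text \<open>Splitting one factor off leaves a product equal to \<one>, hence the empty multiset.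
  Consequently any set of atoms that generates the monoid contains all atoms.\<close>

lemma atom_eq_mset_prod:
  assumes "set_mset z \<subseteq> carrier G - {\<one>}" "mset_prod G z \<in> atoms G"
  shows "z = {#mset_prod G z#}"
proof (cases z)
  case empty
  then show ?thesis using assms(2) by (simp add: atoms_iff)
next
  case (add x z')
  have x: "x \<in> carrier G" "x \<noteq> \<one>" "set_mset z' \<subseteq> carrier G - {\<one>}" using assms(1) add by auto
  then have z: "mset_prod G z = x \<otimes> mset_prod G z'" "mset_prod G z' \<in> carrier G"
    using add mset_prod_add[of x z'] by auto
  then have "mset_prod G z' = \<one>" using assms(2) x unfolding atoms_iff by metis
  then show ?thesis using add x z mset_prod_eq_one by auto
qed

text \<open>Let \<open>e\<close> be in a generating set of least cardinality and
  \<open>e = a \<otimes> b\<close> with both factors different from \<one>. Neither factor can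
  involve \<open>e\<close>, since unit-cancellativity would make the other one \<one>. So
  \<open>e\<close> would be a product of the other generators.\<close>

lemma atomic_if_finitely_generated:
  assumes "finitely_generated_monoid G"
  obtains E where "finite E" "E \<subseteq> atoms G" "carrier G = mset_prod G ` {z. set_mset z \<subseteq> E}"
proof -
  define gen where "gen F \<longleftrightarrow> finite F \<and> F \<subseteq> carrier G \<and> carrier G \<subseteq> mset_prod G ` {z. set_mset z \<subseteq> F}" for F
  obtain F where "finite F" "F \<subseteq> carrier G" "submonoid_generated G F = carrier G"
    using assms unfolding finitely_generated_monoid_def by blast
  then have "gen F" using submonoid_generated_eq[of F] by (simp add: gen_def)
  then obtain E where E: "gen E" and min: "\<And>F. gen F \<Longrightarrow> card E \<le> card F"
    using ex_has_least_nat[of gen F card] by metis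
  have fin: "finite E" and sub: "E \<subseteq> carrier G" using E by (auto simp: gen_def)
  have generated: "\<exists>z. set_mset z \<subseteq> E \<and> x = mset_prod G z" if "x \<in> carrier G" for x
    using E that unfolding gen_def by blast
  \<comment> \<open>Substituting \<open>z\<close> for every occurrence of \<open>e\<close> would
    yield a smaller generating set.\<close>
  have indep: False if e: "e \<in> E" and z: "set_mset z \<subseteq> E - {e}" "e = mset_prod G z" for e z
  proof -
    have "x \<in> mset_prod G ` {z. set_mset z \<subseteq> E - {e}}" if x: "x \<in> carrier G" for x
    proof -
      have "mset_prod G w \<in> mset_prod G ` {z. set_mset z \<subseteq> E - {e}}" if "set_mset w \<subseteq> E" for w
        using that
      proof (induction w)
        case empty
        then show ?case by (auto intro: image_eqI[of _ _ "{#}"])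
      next
        case (add y w)
        then obtain v where v: "set_mset v \<subseteq> E - {e}" "mset_prod G w = mset_prod G v" by auto
        have c: "y \<in> carrier G" "set_mset v \<subseteq> carrier G" "set_mset z \<subseteq> carrier G"
          using add.prems sub v z by auto
        have "mset_prod G (add_mset y w) = y \<otimes> mset_prod G v"
          using add.prems sub v mset_prod_add[of y w] by auto
        also have "\<dots> = mset_prod G ((if y = e then z else {#y#}) + v)"
          using z(2) mset_prod_add[OF c(1,2)] mset_prod_union[OF c(3,2)] by auto
        finally show ?case using add.prems v z by (intro image_eqI[of _ _ "(if y = e then z else {#y#}) + v"]) auto
      qed
      then show ?thesis using generated[OF x] by blast
    qed
    then have "gen (E - {e})" using fin sub by (auto simp: gen_def)
    then have "card E \<le> card (E - {e})" by (rule min)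
    then show False using e fin by (metis card_Diff1_less not_less)
  qed
  have "e \<in> atoms G" if e: "e \<in> E" for e
    unfolding atoms_iff
  proof (intro conjI ballI impI)
    show ec: "e \<in> carrier G" using e sub by blast
    show "e \<noteq> \<one>" using indep[OF e, of "{#}"] by auto
    fix a b assume ab: "a \<in> carrier G" "b \<in> carrier G" "e = a \<otimes> b"
    obtain za zb where za: "set_mset za \<subseteq> E" "a = mset_prod G za" and zb: "set_mset zb \<subseteq> E" "b = mset_prod G zb"
      using generated ab(1,2) by metis
    have absorb: "b' = \<one>" if a': "set_mset z \<subseteq> E" "e \<in># z" "a' = mset_prod G z" "b' \<in> carrier G" "e = a' \<otimes> b'" for z a' b'
    proof -
      obtain w where w: "z = add_mset e w" using a'(2) by (meson multi_member_split)
      then have "set_mset w \<subseteq> carrier G" using a'(1) sub by auto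
      then have c: "mset_prod G w \<in> carrier G" "a' = e \<otimes> mset_prod G w"
        using a'(3) w ec mset_prod_add[of e w] by auto
      then have "e \<otimes> (mset_prod G w \<otimes> b') = a' \<otimes> b'" using a'(4) ec by (simp add: m_assoc)
      then have "e \<otimes> (mset_prod G w \<otimes> b') = e" using a'(5) by simp
      then have "b' \<otimes> mset_prod G w = \<one>"
        using cancel_one[of e "mset_prod G w \<otimes> b'"] c a'(4) ec by (simp add: m_comm)
      then show ?thesis using prod_eq_one c a'(4) by blast
    qed
    show "a = \<one> \<or> b = \<one>"
    proof (rule ccontr)
      assume "\<not> ?thesis"
      then have "e \<notin># za" "e \<notin># zb" using absorb[OF za(1) _ za(2)] absorb[OF zb(1) _ zb(2), of a] ab
        by (auto simp: m_comm)
      then have "set_mset (za + zb) \<subseteq> E - {e}" using za zb by auto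
      moreover have "e = mset_prod G (za + zb)" using ab za zb sub mset_prod_union[of za zb] by auto
      ultimately show False using indep[OF e] by blast
    qed
  qed
  moreover have "mset_prod G ` {z. set_mset z \<subseteq> E} \<subseteq> carrier G" using sub by auto
  ultimately show ?thesis using that[of E] E unfolding gen_def by blast
qed

end

section \<open>Passage to the quotient by the group of units\<close>

definition unit_class :: "('a, 'b) monoid_scheme \<Rightarrow> 'a \<Rightarrow> 'a set" ("\<kappa>\<index>") where
  "\<kappa>\<^bsub>H\<^esub> a = Units H #>\<^bsub>H\<^esub> a"

context unit_cancellative_monoid
begin

lemma mem_unit_class: "x \<in> \<kappa> a \<longleftrightarrow> (\<exists>u\<in>Units G. x = u \<otimes> a)"
  by (auto simp: unit_class_def r_coset_def)

lemma unit_class_eq_iff: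
  assumes "a \<in> carrier G" "b \<in> carrier G"
  shows "\<kappa> a = \<kappa> b \<longleftrightarrow> (\<exists>u\<in>Units G. a = u \<otimes> b)"
proof
  assume "\<kappa> a = \<kappa> b"
  moreover have "a \<in> \<kappa> a" using assms(1) by (auto simp: mem_unit_class intro!: bexI[of _ \<one>])
  ultimately show "\<exists>u\<in>Units G. a = u \<otimes> b" by (simp add: mem_unit_class)
next
  assume "\<exists>u\<in>Units G. a = u \<otimes> b"
  then obtain u where u: "u \<in> Units G" "a = u \<otimes> b" by blast
  have "v \<otimes> a = (v \<otimes> u) \<otimes> b" "v \<otimes> b = (v \<otimes> inv u) \<otimes> a" if "v \<in> Units G" for v
    using that u assms by (simp_all add: m_assoc m_assoc[symmetric, of "inv u"] Units_closed Units_inv_closed)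
  then show "\<kappa> a = \<kappa> b" using u(1) by (auto simp: mem_unit_class set_eq_iff; meson Units_m_closed Units_inv_Units)
qed

lemma carrier_reduced: "carrier (reduced G) = \<kappa> ` carrier G"
  by (auto simp: reduced_def FactGroup_def RCOSETS_def unit_class_def)

lemma one_reduced: "\<one>\<^bsub>reduced G\<^esub> = \<kappa> \<one>"
  by (auto simp: reduced_def FactGroup_def unit_class_def r_coset_def Units_closed)

lemma mult_reduced:
  assumes "a \<in> carrier G" "b \<in> carrier G"
  shows "\<kappa> a \<otimes>\<^bsub>reduced G\<^esub> \<kappa> b = \<kappa> (a \<otimes> b)"
proof -
  have *: "(u \<otimes> a) \<otimes> (v \<otimes> b) = (u \<otimes> v) \<otimes> (a \<otimes> b)" if "u \<in> Units G" "v \<in> Units G" for u v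
    using that assms by (simp add: m_ac Units_closed)
  have "x \<in> \<kappa> a <#> \<kappa> b \<longleftrightarrow> x \<in> \<kappa> (a \<otimes> b)" for x
  proof
    assume "x \<in> \<kappa> a <#> \<kappa> b"
    then obtain u v where "u \<in> Units G" "v \<in> Units G" "x = (u \<otimes> a) \<otimes> (v \<otimes> b)"
      by (auto simp: set_mult_def mem_unit_class)
    then show "x \<in> \<kappa> (a \<otimes> b)" unfolding mem_unit_class using * by (metis Units_m_closed)
  next
    assume "x \<in> \<kappa> (a \<otimes> b)"
    then obtain u where "u \<in> Units G" "x = (u \<otimes> a) \<otimes> (\<one> \<otimes> b)"
      using assms by (auto simp: mem_unit_class m_assoc Units_closed)
    moreover have "b = \<one> \<otimes> b" using assms by simp
    ultimately show "x \<in> \<kappa> a <#> \<kappa> b" unfolding set_mult_def using mem_unit_class by blast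
  qed
  then show ?thesis by (auto simp: reduced_def FactGroup_def)
qed

lemma unit_class_closed [simp, intro]: "a \<in> carrier G \<Longrightarrow> \<kappa> a \<in> carrier (reduced G)"
  by (simp add: carrier_reduced)

lemma unit_class_eq_one: "a \<in> carrier G \<Longrightarrow> \<kappa> a = \<one>\<^bsub>reduced G\<^esub> \<longleftrightarrow> a \<in> Units G"
  by (auto simp: one_reduced unit_class_eq_iff Units_closed)

text \<open>Unit-cancellativity survives: an equation
  \<open>\<kappa> a = \<kappa> (a \<otimes> b)\<close> lifts to
  \<open>a = a \<otimes> b \<otimes> u\<close> with a unit \<open>u\<close>, so \<open>b\<close> is
  a unit and its class is trivial.\<close>

lemma reduced_monoid_reduced: "reduced_monoid (reduced G)"
proof -
  interpret M: comm_monoid "reduced G"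
    by (rule comm_monoidI)
      (auto simp: carrier_reduced mult_reduced one_reduced m_ac)
  show ?thesis
  proof
    show "Units (reduced G) = {\<one>\<^bsub>reduced G\<^esub>}"
    proof (intro equalityI subsetI)
      fix x assume "x \<in> Units (reduced G)"
      then obtain y where "x \<in> carrier (reduced G)" "y \<in> carrier (reduced G)"
        "x \<otimes>\<^bsub>reduced G\<^esub> y = \<one>\<^bsub>reduced G\<^esub>" by (metis M.Units_closed M.Units_r_inv_ex)
      then obtain a b where "x = \<kappa> a" "a \<in> carrier G" "b \<in> carrier G" "\<kappa> (a \<otimes> b) = \<one>\<^bsub>reduced G\<^esub>"
        by (auto simp: carrier_reduced mult_reduced)
      then show "x \<in> {\<one>\<^bsub>reduced G\<^esub>}" using unit_factor[of a b] by (simp add: unit_class_eq_one)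
    qed simp
    fix x y assume "x \<in> carrier (reduced G)" "y \<in> carrier (reduced G)" "x = x \<otimes>\<^bsub>reduced G\<^esub> y"
    then obtain a b where ab: "x = \<kappa> a" "y = \<kappa> b" "a \<in> carrier G" "b \<in> carrier G" "\<kappa> a = \<kappa> (a \<otimes> b)"
      by (auto simp: carrier_reduced mult_reduced)
    then obtain u where "u \<in> Units G" "a = u \<otimes> (a \<otimes> b)" by (auto simp: unit_class_eq_iff)
    then have "a = a \<otimes> b \<otimes> u" using ab by (simp add: m_ac Units_closed)
    then have "b \<in> Units G" using prod_eq_factor_unit ab \<open>u \<in> Units G\<close> Units_closed by blast
    then have "y = \<one>\<^bsub>reduced G\<^esub>" using ab by (simp add: unit_class_eq_one)
    then show "y \<in> Units (reduced G)" by simp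
  qed
qed

interpretation red: reduced_monoid "reduced G"
  by (rule reduced_monoid_reduced)

text \<open>A factorization of the class of \<open>a\<close> lifts to one of \<open>a\<close>, with
  the unit absorbed into the first factor.\<close>

lemma unit_class_atom_iff:
  assumes "a \<in> carrier G"
  shows "\<kappa> a \<in> atoms (reduced G) \<longleftrightarrow> a \<in> atoms G"
proof -
  have "(\<forall>b\<in>carrier G. \<forall>c\<in>carrier G. \<kappa> a = \<kappa> (b \<otimes> c) \<longrightarrow> b \<in> Units G \<or> c \<in> Units G) \<longleftrightarrow>
    (\<forall>b\<in>carrier G. \<forall>c\<in>carrier G. a = b \<otimes> c \<longrightarrow> b \<in> Units G \<or> c \<in> Units G)" (is "?L \<longleftrightarrow> ?R")
  proof
    assume R: ?R
    show ?L
    proof (intro ballI impI)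
      fix b c assume bc: "b \<in> carrier G" "c \<in> carrier G" "\<kappa> a = \<kappa> (b \<otimes> c)"
      then obtain u where u: "u \<in> Units G" "a = u \<otimes> (b \<otimes> c)" using assms by (auto simp: unit_class_eq_iff)
      then have "u \<in> carrier G" "a = (u \<otimes> b) \<otimes> c" using bc(1,2) by (simp_all only: m_assoc Units_closed)
      then have "u \<otimes> b \<in> Units G \<or> c \<in> Units G" using R bc(1,2) m_closed by blast
      then show "b \<in> Units G \<or> c \<in> Units G"
        using unit_factor[of b u] m_comm[of b u] bc u Units_closed by auto
    qed
  qed metis
  then show ?thesis using assms
    by (simp add: atoms_def red.Units_eq unit_class_eq_one carrier_reduced mult_reduced)
qed

lemma mset_prod_unit_class:
  "set_mset y \<subseteq> carrier G \<Longrightarrow> mset_prod (reduced G) (image_mset \<kappa> y) = \<kappa> (mset_prod G y)"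
proof (induction y)
  case (add x y)
  have y: "x \<in> carrier G" "set_mset y \<subseteq> carrier G" using add.prems by auto
  then have "set_mset (image_mset \<kappa> y) \<subseteq> carrier (reduced G)" by auto
  then have "mset_prod (reduced G) (image_mset \<kappa> (add_mset x y)) = \<kappa> x \<otimes>\<^bsub>reduced G\<^esub> \<kappa> (mset_prod G y)"
    using y add.IH by (simp add: red.mset_prod_add)
  also have "\<dots> = \<kappa> (mset_prod G (add_mset x y))" using y by (simp add: mult_reduced mset_prod_add)
  finally show ?case .
next
  case empty
  show ?case using red.mset_prod_empty by (simp add: one_reduced)
qed

end

section \<open>The factorizations of an almost free monoid\<close>

text \<open>The kernel congruence of the factorization epimorphism from \<open>\<Z>(H)\<close> onto
  the reduced monoid.\<close>

definition same_product ::
    "('a, 'b) monoid_scheme \<Rightarrow> 'a set multiset \<Rightarrow> 'a set multiset \<Rightarrow> bool" where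
  "same_product H z z' \<longleftrightarrow> set_mset z \<subseteq> atoms (reduced H) \<and> set_mset z' \<subseteq> atoms (reduced H) \<and>
     mset_prod (reduced H) z = mset_prod (reduced H) z'"

text \<open>The interface between the two halves of the argument: the direct decomposition serves to
  establish it, and the arithmetical invariants are bounded from it.\<close>

locale almost_free_monoid = unit_cancellative_monoid G for G (structure) +
  fixes E :: "'a set set"
  assumes almost_free: "almost_free_congruence (atoms (reduced G)) E (same_product G)"
    and atomic: "a \<in> carrier G \<Longrightarrow>
      \<exists>z. set_mset z \<subseteq> atoms (reduced G) \<and> mset_prod (reduced G) z = \<kappa> a"

section \<open>The atoms and the kernel congruence of \<open>F(P) x T\<close>\<close>

locale free_times_finitely_generated = unit_cancellative_monoid G for G (structure) +
  fixes P T :: "'a set"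
  assumes P_carrier: "P \<subseteq> carrier G"
    and P_prime: "p \<in> P \<Longrightarrow> Divisibility.prime G p"
    and T_submonoid: "submonoid T G"
    and free_times: "free_times G P T"
    and T_finitely_generated: "finitely_generated_monoid (reduced (G\<lparr>carrier := T\<rparr>))"
begin

lemma T_carrier: "T \<subseteq> carrier G"
  using T_submonoid by (rule submonoid.subset)

lemma T_mult: "s \<in> T \<Longrightarrow> t \<in> T \<Longrightarrow> s \<otimes> t \<in> T"
  using T_submonoid by (rule submonoid.m_closed)

lemma one_T: "\<one> \<in> T"
  using T_submonoid by (rule submonoid.one_closed)

lemma P_set_carrier: "set_mset y \<subseteq> P \<Longrightarrow> set_mset y \<subseteq> carrier G"
  using P_carrier by blast

lemma decomposition:
  shows decomposition_exists: "h \<in> carrier G \<Longrightarrow>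
      \<exists>y t. set_mset y \<subseteq> P \<and> t \<in> T \<and> h = mset_prod G y \<otimes> t" (is "_ \<Longrightarrow> ?ex")
    and decomposition_unique: "\<lbrakk>set_mset y \<subseteq> P; set_mset y' \<subseteq> P; t \<in> T; t' \<in> T;
      mset_prod G y \<otimes> t = mset_prod G y' \<otimes> t'\<rbrakk> \<Longrightarrow> y = y' \<and> t = t'"
proof -
  define F where "F = submonoid_generated G P"
  have F: "submonoid F G" and PF: "P \<subseteq> F"
    and bij: "bij_betw (mset_prod (G\<lparr>carrier := F\<rparr>)) {z. set_mset z \<subseteq> P} F"
    and bij2: "bij_betw (\<lambda>(a, b). a \<otimes> b) (F \<times> T) (carrier G)"
    using free_times
    by (auto simp: free_times_def internal_direct_product_def free_abelian_with_basis_def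
        free_abelian_monoid_def iso_def DirProd_def F_def)
  have eq: "mset_prod (G\<lparr>carrier := F\<rparr>) z = mset_prod G z" "mset_prod G z \<in> F" if "set_mset z \<subseteq> P" for z
    using mset_prod_submonoid[OF F, of z] that PF by auto
  show ?ex if h: "h \<in> carrier G"
  proof -
    have "h \<in> (\<lambda>(a, b). a \<otimes> b) ` (F \<times> T)" using bij2 h by (simp add: bij_betw_def)
    then obtain f t where ft: "f \<in> F" "t \<in> T" "h = f \<otimes> t" by auto
    have "f \<in> mset_prod (G\<lparr>carrier := F\<rparr>) ` {z. set_mset z \<subseteq> P}"
      using bij ft(1) by (simp add: bij_betw_def)
    then obtain y where "set_mset y \<subseteq> P" "f = mset_prod G y" using eq(1) by force
    then show ?thesis using ft by blast
  qed
  show "y = y' \<and> t = t'" if y: "set_mset y \<subseteq> P" "set_mset y' \<subseteq> P" and t: "t \<in> T" "t' \<in> T"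
    and yt: "mset_prod G y \<otimes> t = mset_prod G y' \<otimes> t'"
  proof -
    have "(mset_prod G y, t) = (mset_prod G y', t')"
      using bij2 yt y t eq(2) by (intro inj_onD[of "\<lambda>(a, b). a \<otimes> b" "F \<times> T"]) (auto simp: bij_betw_def)
    then show ?thesis
      using bij y eq(1) by (auto simp: bij_betw_def inj_on_def)
  qed
qed

text \<open>The parts over \<open>P\<close> add up under multiplication, so if their sum is empty,
  both are. Divisor-closedness puts all units into \<open>T\<close> and keeps atoms of its reduction
  atoms in the large one.\<close>

lemma divisor_of_T:
  assumes "a \<in> carrier G" "b \<in> carrier G" "a \<otimes> b \<in> T"
  shows "a \<in> T"
proof -
  obtain y t where a: "set_mset y \<subseteq> P" "t \<in> T" "a = mset_prod G y \<otimes> t"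
    using decomposition_exists assms(1) by blast
  obtain y' t' where b: "set_mset y' \<subseteq> P" "t' \<in> T" "b = mset_prod G y' \<otimes> t'"
    using decomposition_exists assms(2) by blast
  have c: "mset_prod G y \<in> carrier G" "mset_prod G y' \<in> carrier G" "t \<in> carrier G" "t' \<in> carrier G"
    using a b T_carrier P_set_carrier by auto
  have "mset_prod G (y + y') \<otimes> (t \<otimes> t') = mset_prod G {#} \<otimes> (a \<otimes> b)"
    using a b c P_set_carrier by (simp add: mset_prod_union m_ac)
  then have "y + y' = {#}"
    using decomposition_unique[OF _ _ T_mult[OF a(2) b(2)] assms(3), of "y + y'" "{#}"] a(1) b(1) by simp
  then show ?thesis using a c by simp
qed

lemma Units_T: "Units G \<subseteq> T"
proof
  fix u assume "u \<in> Units G"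
  then have "u \<in> carrier G" "inv u \<in> carrier G" "u \<otimes> inv u = \<one>" by auto
  then show "u \<in> T" using divisor_of_T[of u "inv u"] one_T by simp
qed

lemma mem_T_if_unit_class:
  assumes "a \<in> carrier G" "t \<in> T" "\<kappa> a = \<kappa> t"
  shows "a \<in> T"
proof -
  have "t \<in> carrier G" using assms(2) T_carrier by blast
  then obtain u where "u \<in> Units G" "a = u \<otimes> t" using assms(1,3) unit_class_eq_iff by blast
  then show ?thesis using assms(2) Units_T T_mult by auto
qed

lemma Units_T_eq: "Units (G\<lparr>carrier := T\<rparr>) = Units G"
proof
  show "Units (G\<lparr>carrier := T\<rparr>) \<subseteq> Units G" using T_carrier by (auto simp: Units_def)
  show "Units G \<subseteq> Units (G\<lparr>carrier := T\<rparr>)"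
  proof
    fix u assume u: "u \<in> Units G"
    then have "u \<in> T" "inv u \<in> T" using Units_T by auto
    moreover have "inv u \<otimes> u = \<one>" "u \<otimes> inv u = \<one>" using u by auto
    ultimately show "u \<in> Units (G\<lparr>carrier := T\<rparr>)" unfolding Units_def by auto
  qed
qed

text \<open>As both monoids have the same units, the unit classes of \<open>T\<close> are literally
  unit classes of \<open>G\<close>, and no embedding has to be carried along.\<close>

lemma reduced_T: "reduced (G\<lparr>carrier := T\<rparr>) = (reduced G)\<lparr>carrier := \<kappa> ` T\<rparr>"
proof -
  have "rcosets\<^bsub>G\<lparr>carrier := T\<rparr>\<^esub> Units G = \<kappa> ` T"
    unfolding RCOSETS_def r_coset_def unit_class_def by auto
  moreover have "set_mult (G\<lparr>carrier := T\<rparr>) = set_mult G"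
    unfolding fun_eq_iff set_mult_def by simp
  ultimately show ?thesis unfolding reduced_def FactGroup_def Units_T_eq by simp
qed

lemma unit_cancellative_T: "unit_cancellative_monoid (G\<lparr>carrier := T\<rparr>)"
proof -
  interpret T: comm_monoid "G\<lparr>carrier := T\<rparr>" by (rule submonoid_comm_monoid[OF T_submonoid])
  show ?thesis
  proof
    fix a u assume "a \<in> carrier (G\<lparr>carrier := T\<rparr>)" "u \<in> carrier (G\<lparr>carrier := T\<rparr>)"
      and eq: "a = a \<otimes>\<^bsub>G\<lparr>carrier := T\<rparr>\<^esub> u"
    then have "a \<in> carrier G" "u \<in> carrier G" using T_carrier by auto
    moreover have "a = a \<otimes> u" using eq by simp
    ultimately show "u \<in> Units (G\<lparr>carrier := T\<rparr>)" unfolding Units_T_eq by (rule unit_cancel)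
  qed
qed

interpretation red: reduced_monoid "reduced G"
  by (rule reduced_monoid_reduced)

text \<open>If \<open>p = a \<otimes> b\<close> and \<open>p\<close> divides \<open>a\<close>, then
  \<open>p = p \<otimes> b \<otimes> c\<close> for some \<open>c\<close>, so \<open>b\<close> is a
  unit by unit-cancellativity.\<close>

lemma prime_class_atom: "p \<in> P \<Longrightarrow> \<kappa> p \<in> atoms (reduced G)"
proof -
  assume p: "p \<in> P"
  have pc: "p \<in> carrier G" and pu: "p \<notin> Units G" using p P_carrier P_prime by (auto simp: Divisibility.prime_def)
  have *: "b \<in> Units G" if ab: "a \<in> carrier G" "b \<in> carrier G" "p = a \<otimes> b" "p divides a" for a b
  proof -
    obtain c where c: "c \<in> carrier G" "a = p \<otimes> c" using ab(4) by (auto simp: factor_def)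
    have "p \<otimes> b \<otimes> c = (p \<otimes> c) \<otimes> b" using ab(2) c(1) pc by (simp add: m_ac)
    also have "\<dots> = p" using ab(3) c(2) by simp
    finally show ?thesis using prod_eq_factor_unit[OF pc ab(2) c(1)] by simp
  qed
  have "a \<in> Units G \<or> b \<in> Units G" if ab: "a \<in> carrier G" "b \<in> carrier G" "p = a \<otimes> b" for a b
  proof -
    have "p divides a \<otimes> b" using ab pc by (auto simp: factor_def intro!: bexI[of _ \<one>])
    then have "p divides a \<or> p divides b" using P_prime[OF p] ab unfolding Divisibility.prime_def by blast
    moreover have "p = b \<otimes> a" using ab m_comm by simp
    ultimately show ?thesis using * ab by blast
  qed
  then have "p \<in> atoms G" using pc pu by (auto simp: atoms_def)
  then show ?thesis using pc by (simp add: unit_class_atom_iff)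
qed

lemma almost_free_monoid_exists: "\<exists>E. almost_free_monoid G E"
proof -
  let ?M = "reduced G" let ?N = "reduced (G\<lparr>carrier := T\<rparr>)"
  interpret T: unit_cancellative_monoid "G\<lparr>carrier := T\<rparr>" by (rule unit_cancellative_T)
  interpret N: reduced_monoid ?N by (rule T.reduced_monoid_reduced)
  have kT: "submonoid (\<kappa> ` T) ?M"
  proof
    show "\<kappa> ` T \<subseteq> carrier ?M" using T_carrier by blast
    show "\<one>\<^bsub>?M\<^esub> \<in> \<kappa> ` T" using one_T one_reduced by blast
    fix x y assume "x \<in> \<kappa> ` T" "y \<in> \<kappa> ` T"
    then obtain s t where st: "s \<in> T" "t \<in> T" "x = \<kappa> s" "y = \<kappa> t" by blast
    then have "x \<otimes>\<^bsub>?M\<^esub> y = \<kappa> (s \<otimes> t)" using T_carrier mult_reduced by blast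
    then show "x \<otimes>\<^bsub>?M\<^esub> y \<in> \<kappa> ` T" using T_mult st by blast
  qed
  obtain E where E: "finite E" "E \<subseteq> atoms ?N" "carrier ?N = mset_prod ?N ` {z. set_mset z \<subseteq> E}"
    using N.atomic_if_finitely_generated[OF T_finitely_generated] by blast
  have E_T: "E \<subseteq> \<kappa> ` T" using E(2) by (auto simp: atoms_def reduced_T)
  have prod_N: "mset_prod ?N z = mset_prod ?M z" "mset_prod ?M z \<in> \<kappa> ` T" if "set_mset z \<subseteq> E" for z
    using red.mset_prod_submonoid[OF kT, of z] that E_T by (auto simp: reduced_T)
  define A where "A = \<kappa> ` P \<union> E"
  have E_atom: "e \<in> atoms ?M" if e: "e \<in> E" for e
    unfolding red.atoms_iff
  proof (intro conjI ballI impI)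
    have N: "e \<in> carrier ?N" "e \<noteq> \<one>\<^bsub>?N\<^esub>" "\<And>x y. \<lbrakk>x \<in> \<kappa> ` T; y \<in> \<kappa> ` T; e = x \<otimes>\<^bsub>?M\<^esub> y\<rbrakk> \<Longrightarrow> x = \<one>\<^bsub>?M\<^esub> \<or> y = \<one>\<^bsub>?M\<^esub>"
    proof -
      have "e \<in> atoms ?N" using e E(2) by blast
      note N = this[unfolded N.atoms_iff]
      then show "e \<in> carrier ?N" "e \<noteq> \<one>\<^bsub>?N\<^esub>" by blast+
      have "\<forall>x\<in>\<kappa> ` T. \<forall>y\<in>\<kappa> ` T. e = x \<otimes>\<^bsub>?M\<^esub> y \<longrightarrow> x = \<one>\<^bsub>?M\<^esub> \<or> y = \<one>\<^bsub>?M\<^esub>"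
        using N unfolding reduced_T by simp
      then show "\<And>x y. \<lbrakk>x \<in> \<kappa> ` T; y \<in> \<kappa> ` T; e = x \<otimes>\<^bsub>?M\<^esub> y\<rbrakk> \<Longrightarrow> x = \<one>\<^bsub>?M\<^esub> \<or> y = \<one>\<^bsub>?M\<^esub>"
        by blast
    qed
    then show "e \<in> carrier ?M" "e \<noteq> \<one>\<^bsub>?M\<^esub>" using T_carrier by (auto simp: reduced_T)
    fix x y assume xy: "x \<in> carrier ?M" "y \<in> carrier ?M" "e = x \<otimes>\<^bsub>?M\<^esub> y"
    then obtain a b where ab: "a \<in> carrier G" "b \<in> carrier G" "x = \<kappa> a" "y = \<kappa> b"
      by (auto simp: carrier_reduced)
    obtain t where t: "t \<in> T" "e = \<kappa> t" using e E_T by blast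
    then have "\<kappa> (a \<otimes> b) = \<kappa> t" using ab xy by (simp add: mult_reduced)
    then have "a \<otimes> b \<in> T" using mem_T_if_unit_class[OF _ t(1)] ab by simp
    moreover have "b \<otimes> a = a \<otimes> b" using ab(1,2) by (rule m_comm[rotated])
    ultimately have "a \<in> T" "b \<in> T" using divisor_of_T ab(1,2) by metis+
    then show "x = \<one>\<^bsub>?M\<^esub> \<or> y = \<one>\<^bsub>?M\<^esub>" using N(3)[of x y] ab(3,4) xy(3) by blast
  qed
  have A_atoms: "A \<subseteq> atoms ?M" using E_atom prime_class_atom by (auto simp: A_def)
  have atoms_sub: "atoms ?M \<subseteq> carrier ?M - {\<one>\<^bsub>?M\<^esub>}" by (auto simp: red.atoms_iff)
  have factor: "\<exists>z. set_mset z \<subseteq> A \<and> mset_prod ?M z = \<kappa> a" if a: "a \<in> carrier G" for a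
  proof -
    obtain y t where yt: "set_mset y \<subseteq> P" "t \<in> T" "a = mset_prod G y \<otimes> t"
      using decomposition_exists a by blast
    have "\<kappa> t \<in> carrier ?N" using yt by (simp add: reduced_T)
    then obtain z where z: "set_mset z \<subseteq> E" "\<kappa> t = mset_prod ?M z"
      unfolding E(3) using prod_N(1) by force
    have sub: "set_mset (image_mset \<kappa> y + z) \<subseteq> A" using z yt by (auto simp: A_def)
    then have "set_mset (image_mset \<kappa> y + z) \<subseteq> carrier ?M" using A_atoms atoms_sub by blast
    then have "set_mset (image_mset \<kappa> y) \<subseteq> carrier ?M" "set_mset z \<subseteq> carrier ?M" by simp_all
    then have "mset_prod ?M (image_mset \<kappa> y + z) = \<kappa> (mset_prod G y) \<otimes>\<^bsub>?M\<^esub> \<kappa> t"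
      using yt z P_set_carrier by (simp add: red.mset_prod_union mset_prod_unit_class)
    also have "\<dots> = \<kappa> a" using yt P_set_carrier T_carrier by (simp add: mult_reduced subset_iff)
    finally show ?thesis using sub by blast
  qed
  \<comment> \<open>The set \<open>A\<close> consists of atoms and generates \<open>?M\<close> by
    \<open>factor\<close>, and an atom factors only as itself.\<close>
  have A_eq: "atoms ?M = A"
  proof (intro equalityI subsetI)
    fix x assume x: "x \<in> atoms ?M"
    then obtain a where "a \<in> carrier G" "x = \<kappa> a" by (auto simp: atoms_def carrier_reduced)
    then obtain z where z: "set_mset z \<subseteq> A" "mset_prod ?M z = x" using factor by blast
    then have "z = {#x#}" using red.atom_eq_mset_prod[of z] x A_atoms atoms_sub by blast
    then show "x \<in> A" using z by simp
  qed (use A_atoms in blast)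
  \<comment> \<open>The atoms outside \<open>E\<close> are classes of primes; choosing
    representatives turns them into a multiset over \<open>P\<close>, to which uniqueness of the
    decomposition in \<open>G\<close> applies.\<close>
  have normal_form: "\<exists>y t. set_mset y \<subseteq> P \<and> t \<in> T \<and> filter_mset (\<lambda>x. x \<notin> E) z = image_mset \<kappa> y \<and>
      mset_prod ?M (filter_mset (\<lambda>x. x \<in> E) z) = \<kappa> t \<and> mset_prod ?M z = \<kappa> (mset_prod G y \<otimes> t)"
    if z: "set_mset z \<subseteq> A" for z
  proof -
    let ?f = "filter_mset (\<lambda>x. x \<notin> E) z" and ?e = "filter_mset (\<lambda>x. x \<in> E) z"
    have fP: "set_mset ?f \<subseteq> \<kappa> ` P" using z by (auto simp: A_def)
    define y where "y = image_mset (inv_into P \<kappa>) ?f"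
    have y: "set_mset y \<subseteq> P" using fP by (auto simp: y_def intro: inv_into_into)
    have "image_mset \<kappa> y = image_mset id ?f"
      unfolding y_def image_mset.compositionality using fP
      by (intro image_mset_cong) (auto simp: f_inv_into_f subset_iff)
    then have fy: "?f = image_mset \<kappa> y" by simp
    obtain t where t: "t \<in> T" "mset_prod ?M ?e = \<kappa> t" using prod_N(2)[of ?e] by force
    have "set_mset z \<subseteq> carrier ?M" using z A_atoms atoms_sub by blast
    then have "set_mset ?f \<subseteq> carrier ?M" "set_mset ?e \<subseteq> carrier ?M" by auto
    then have "mset_prod ?M (?e + ?f) = \<kappa> t \<otimes>\<^bsub>?M\<^esub> \<kappa> (mset_prod G y)"
      using y t P_set_carrier by (simp only: red.mset_prod_union fy mset_prod_unit_class)
    also have "\<dots> = \<kappa> (mset_prod G y \<otimes> t)"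
      using y t P_set_carrier T_carrier by (simp add: mult_reduced m_comm subset_iff)
    also have "?e + ?f = z" by (rule multiset_partition[symmetric])
    finally show ?thesis using y t fy by blast
  qed
  have split: "filter_mset (\<lambda>x. x \<notin> E) z = filter_mset (\<lambda>x. x \<notin> E) z' \<and>
      mset_prod ?M (filter_mset (\<lambda>x. x \<in> E) z) = mset_prod ?M (filter_mset (\<lambda>x. x \<in> E) z')"
    if sub: "set_mset z \<subseteq> A" "set_mset z' \<subseteq> A" and eq: "mset_prod ?M z = mset_prod ?M z'" for z z'
  proof -
    obtain y t where y: "set_mset y \<subseteq> P" "t \<in> T" "filter_mset (\<lambda>x. x \<notin> E) z = image_mset \<kappa> y"
      "mset_prod ?M (filter_mset (\<lambda>x. x \<in> E) z) = \<kappa> t" "mset_prod ?M z = \<kappa> (mset_prod G y \<otimes> t)"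
      using normal_form[OF sub(1)] by blast
    obtain y' t' where y': "set_mset y' \<subseteq> P" "t' \<in> T" "filter_mset (\<lambda>x. x \<notin> E) z' = image_mset \<kappa> y'"
      "mset_prod ?M (filter_mset (\<lambda>x. x \<in> E) z') = \<kappa> t'" "mset_prod ?M z' = \<kappa> (mset_prod G y' \<otimes> t')"
      using normal_form[OF sub(2)] by blast
    have c: "mset_prod G y \<in> carrier G" "mset_prod G y' \<in> carrier G" "t \<in> carrier G" "t' \<in> carrier G"
      using y y' T_carrier P_set_carrier by auto
    have "\<kappa> (mset_prod G y \<otimes> t) = \<kappa> (mset_prod G y' \<otimes> t')" using y y' eq by simp
    then obtain u where u: "u \<in> Units G" "mset_prod G y \<otimes> t = u \<otimes> (mset_prod G y' \<otimes> t')"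
      using c unit_class_eq_iff[of "mset_prod G y \<otimes> t" "mset_prod G y' \<otimes> t'"] by blast
    \<comment> \<open>Equality in \<open>?M\<close> holds in \<open>G\<close> only up to the unit
      \<open>u\<close>. Since \<open>u\<close> lies in \<open>T\<close>, it is absorbed into
      \<open>t'\<close>, and the parts over \<open>P\<close> must coincide.\<close>
    have "u \<otimes> (mset_prod G y' \<otimes> t') = mset_prod G y' \<otimes> (u \<otimes> t')" using c u by (simp add: m_ac Units_closed)
    moreover have "u \<otimes> t' \<in> T" using u y' Units_T T_mult by blast
    ultimately have "y = y'" "t = u \<otimes> t'" using decomposition_unique[of y y' t "u \<otimes> t'"] u y y' by auto
    moreover from this have "\<kappa> t = \<kappa> t'" using u(1) c unit_class_eq_iff by blast
    ultimately show ?thesis using y y' by simp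
  qed
  have A_M: "set_mset z \<subseteq> carrier ?M" if "set_mset z \<subseteq> A" for z
    using that A_atoms atoms_sub by blast
  have "almost_free_congruence A E (same_product G)"
  proof
    show "finite E" "E \<subseteq> A" by (auto simp: E A_def)
    show "same_product G (z + w) (z' + w)" if "same_product G z z'" "set_mset w \<subseteq> A" for z z' w
      using that by (auto simp: same_product_def A_eq red.mset_prod_union A_M)
    show "y = {#}" if "same_product G (z + y) z" for z y
    proof -
      have zy: "set_mset z \<subseteq> A" "set_mset y \<subseteq> A" "mset_prod ?M (z + y) = mset_prod ?M z"
        using that by (auto simp: same_product_def A_eq)
      then have "mset_prod ?M y = \<one>\<^bsub>?M\<^esub>"
        using red.cancel_one[of "mset_prod ?M z" "mset_prod ?M y"] A_M by (simp add: red.mset_prod_union)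
      then show ?thesis using red.mset_prod_eq_one[of y] zy A_atoms atoms_sub by blast
    qed
  qed (use split in \<open>auto simp: same_product_def A_eq\<close>)
  then have "almost_free_congruence (atoms ?M) E (same_product G)" by (simp only: A_eq)
  moreover have "\<exists>z. set_mset z \<subseteq> atoms ?M \<and> mset_prod ?M z = \<kappa> a" if "a \<in> carrier G" for a
    using factor[OF that] by (simp only: A_eq)
  ultimately have "almost_free_monoid G E"
    by (rule almost_free_monoid.intro[OF unit_cancellative_monoid_axioms almost_free_monoid_axioms.intro])
  then show ?thesis by blast
qed

end

section \<open>Arithmetical invariants\<close>

text \<open>Each element of \<open>m\<close> can be charged to one summand containing it. This
  converts a bound on a sub-multiset into a bound on a number of factors.\<close>

lemma subset_sum_mset_support:
  assumes "finite I" "m \<subseteq># (\<Sum>i\<in>I. z i)"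
  shows "\<exists>\<Omega>\<subseteq>I. card \<Omega> \<le> size m \<and> m \<subseteq># (\<Sum>i\<in>\<Omega>. z i)"
  using assms
proof (induction I arbitrary: m)
  case empty
  then show ?case by auto
next
  case (insert i I)
  have "m - z i \<subseteq># (\<Sum>i\<in>I. z i)"
    using insert.prems insert.hyps by (simp add: subset_eq_diff_conv add.commute)
  then obtain \<Omega> where \<Omega>: "\<Omega> \<subseteq> I" "card \<Omega> \<le> size (m - z i)" "m - z i \<subseteq># (\<Sum>i\<in>\<Omega>. z i)"
    using insert.IH by blast
  have fin: "finite \<Omega>" "i \<notin> \<Omega>" using \<Omega>(1) insert.hyps finite_subset by auto
  have split: "m = (m - z i) + (m \<inter># z i)" by (auto simp: multiset_eq_iff min_def)
  show ?case
  proof (cases "m \<inter># z i = {#}")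
    case True
    then have "m - z i = m" using split by simp
    then show ?thesis using \<Omega> by auto
  next
    case False
    have "size m = size (m - z i) + size (m \<inter># z i)" using split by (metis size_union)
    moreover have "0 < size (m \<inter># z i)" using False by (simp add: nonempty_has_size)
    ultimately have "card (insert i \<Omega>) \<le> size m" using \<Omega>(2) fin by simp
    moreover have "m \<subseteq># (\<Sum>i\<in>insert i \<Omega>. z i)"
      using \<Omega>(3) fin by (simp add: subset_eq_diff_conv add.commute)
    ultimately show ?thesis using \<Omega>(1) by (intro exI[of _ "insert i \<Omega>"]) auto
  qed
qed

lemma (in comm_monoid) foldr_eq_mset_prod:
  "set as \<subseteq> carrier G \<Longrightarrow> foldr (\<otimes>) as \<one> = mset_prod G (mset as)"
  by (induction as) (auto simp: mset_prod_add)

context almost_free_monoid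
begin

sublocale cong: almost_free_congruence "atoms (reduced G)" E "same_product G"
  by (rule almost_free)

interpretation red: reduced_monoid "reduced G"
  by (rule reduced_monoid_reduced)

lemma atoms_carrier: "set_mset z \<subseteq> atoms (reduced G) \<Longrightarrow> set_mset z \<subseteq> carrier (reduced G)"
  by (auto simp: atoms_def)

lemma mem_factorizations: "z \<in> factorizations G a \<longleftrightarrow>
    set_mset z \<subseteq> atoms (reduced G) \<and> mset_prod (reduced G) z = \<kappa> a"
  by (simp add: factorizations_def factorization_monoid_def free_abelian_monoid_def unit_class_def)

lemma factorizations_same_product:
  "z \<in> factorizations G a \<Longrightarrow> same_product G z' z \<longleftrightarrow> z' \<in> factorizations G a"
  by (auto simp: mem_factorizations same_product_def)

lemma factorization_of_product:
  assumes "set_mset z \<subseteq> atoms (reduced G)"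
  obtains a where "a \<in> carrier G" "z \<in> factorizations G a"
proof -
  have "mset_prod (reduced G) z \<in> carrier (reduced G)" using atoms_carrier[OF assms] by simp
  then obtain a where "a \<in> carrier G" "mset_prod (reduced G) z = \<kappa> a" by (auto simp: carrier_reduced)
  then show ?thesis using that assms mem_factorizations by blast
qed

lemma factorizations_unit:
  assumes "a \<in> Units G"
  shows "factorizations G a = {{#}}"
proof -
  have "\<kappa> a = \<one>\<^bsub>reduced G\<^esub>" using assms unit_class_eq_one[of a] by auto
  moreover have "atoms (reduced G) \<subseteq> carrier (reduced G) - {\<one>\<^bsub>reduced G\<^esub>}"
    by (auto simp: red.atoms_iff)
  ultimately have "z = {#}" if "z \<in> factorizations G a" for z
    using that red.mset_prod_eq_one[of z] unfolding mem_factorizations by (metis subset_trans)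
  moreover have "{#} \<in> factorizations G a"
    using \<open>\<kappa> a = _\<close> red.mset_prod_empty unfolding mem_factorizations by simp
  ultimately show ?thesis by blast
qed

text \<open>Lifting a factorization from the reduced monoid through representatives of its atoms
  gives \<open>a\<close> only up to a unit. For a non-unit \<open>a\<close> there is at least one
  atom, and it absorbs this unit.\<close>

lemma length_set_eq:
  assumes a: "a \<in> carrier G"
  shows "length_set G a = size ` factorizations G a"
proof (cases "a \<in> Units G")
  case True
  then show ?thesis by (simp add: length_set_def factorizations_unit)
next
  case False
  have "k \<in> size ` factorizations G a" if "set as \<subseteq> atoms G" "length as = k" "foldr (\<otimes>) as \<one> = a" for as k
  proof -
    have c: "set as \<subseteq> carrier G" using that(1) by (auto simp: atoms_def)
    then have "mset_prod (reduced G) (image_mset \<kappa> (mset as)) = \<kappa> a"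
      using that(3) by (simp add: mset_prod_unit_class foldr_eq_mset_prod)
    moreover have "set_mset (image_mset \<kappa> (mset as)) \<subseteq> atoms (reduced G)"
      using c that(1) unit_class_atom_iff by auto
    ultimately have "image_mset \<kappa> (mset as) \<in> factorizations G a" by (simp only: mem_factorizations simp_thms)
    then show ?thesis using that(2) by (intro image_eqI[of _ _ "image_mset \<kappa> (mset as)"]) simp_all
  qed
  moreover have "\<exists>as. length as = size z \<and> set as \<subseteq> atoms G \<and> foldr (\<otimes>) as \<one> = a"
    if z: "z \<in> factorizations G a" for z
  proof -
    have zA: "set_mset z \<subseteq> atoms (reduced G)" "mset_prod (reduced G) z = \<kappa> a"
      using z by (simp_all only: mem_factorizations)
    have "\<forall>x\<in>atoms (reduced G). \<exists>p\<in>atoms G. x = \<kappa> p"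
    proof
      fix x assume x: "x \<in> atoms (reduced G)"
      then have "x \<in> carrier (reduced G)" by (simp add: atoms_def)
      then obtain p where "p \<in> carrier G" "x = \<kappa> p" unfolding carrier_reduced by blast
      then show "\<exists>p\<in>atoms G. x = \<kappa> p" using x unit_class_atom_iff by blast
    qed
    then obtain g where g: "\<And>x. x \<in> atoms (reduced G) \<Longrightarrow> g x \<in> atoms G \<and> \<kappa> (g x) = x" by metis
    define y where "y = image_mset g z"
    have y: "set_mset y \<subseteq> atoms G" using zA(1) g by (auto simp: y_def)
    then have yc: "set_mset y \<subseteq> carrier G" by (auto simp: atoms_def)
    have "image_mset \<kappa> y = image_mset id z"
      unfolding y_def image_mset.compositionality using zA(1) g
      by (intro image_mset_cong) (simp add: subset_iff)
    then have "\<kappa> (mset_prod G y) = \<kappa> a" using zA(2) mset_prod_unit_class[OF yc] by simp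
    then obtain u where u: "u \<in> Units G" "a = u \<otimes> mset_prod G y"
      using unit_class_eq_iff[of a "mset_prod G y"] a yc mset_prod_closed by metis
    have "y \<noteq> {#}" using u False by auto
    then obtain p y' where py: "y = add_mset p y'" by (meson multiset_cases)
    have pc: "p \<in> carrier G" "set_mset y' \<subseteq> carrier G" "u \<in> carrier G" using py yc u(1) by auto
    have "\<kappa> (u \<otimes> p) = \<kappa> p" using unit_class_eq_iff[of "u \<otimes> p" p] u(1) pc by blast
    then have "u \<otimes> p \<in> atoms G"
      using unit_class_atom_iff[of p] unit_class_atom_iff[of "u \<otimes> p"] y py pc by simp
    moreover obtain bs where bs: "mset bs = y'" using ex_mset by blast
    ultimately have "set ((u \<otimes> p) # bs) \<subseteq> atoms G" using y py by auto
    moreover have "length ((u \<otimes> p) # bs) = size z" using py bs y_def by (metis size_image_mset size_mset size_add_mset length_Cons)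
    moreover have "foldr (\<otimes>) ((u \<otimes> p) # bs) \<one> = a"
    proof -
      have "foldr (\<otimes>) ((u \<otimes> p) # bs) \<one> = (u \<otimes> p) \<otimes> mset_prod G y'"
        using foldr_eq_mset_prod[of bs] bs pc by auto
      also have "\<dots> = a" using u(2) py pc by (simp add: mset_prod_add m_assoc)
      finally show ?thesis .
    qed
    ultimately show ?thesis by blast
  qed
  ultimately show ?thesis using False unfolding length_set_def by (auto simp del: foldr.simps)
qed

lemma length_system_eq: "length_system G = (\<lambda>a. size ` factorizations G a) ` carrier G"
  unfolding length_system_def by (rule image_cong) (simp_all add: length_set_eq)

lemma finite_distances: "finite (distances G)"
proof -
  obtain N where N: "\<And>z z'. \<lbrakk>same_product G z z'; size z < size z';
    \<And>y. same_product G y z \<Longrightarrow> \<not> (size z < size y \<and> size y < size z')\<rbrakk> \<Longrightarrow> size z' - size z \<le> N"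
    using cong.bounded_gaps by metis
  have "d \<le> N" if d: "d \<in> distances G" for d
  proof -
    obtain a where a: "a \<in> carrier G" "d \<in> set_distances (size ` factorizations G a)"
      using d by (auto simp: distances_def length_system_eq)
    then obtain z z' where z: "0 < d" "z \<in> factorizations G a" "z' \<in> factorizations G a" "size z' = size z + d"
      "size ` factorizations G a \<inter> {size z..size z'} = {size z, size z'}"
      unfolding set_distances_def by auto
    have "\<not> (size z < size y \<and> size y < size z')" if "same_product G y z" for y
    proof
      assume y: "size z < size y \<and> size y < size z'"
      have "y \<in> factorizations G a" using that z(2) factorizations_same_product by blast
      then have "size y \<in> size ` factorizations G a \<inter> {size z..size z'}" using y by auto
      then show False using y unfolding z(5) by auto
    qed
    moreover have "same_product G z z'" using factorizations_same_product z(2,3) by blast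
    moreover have "size z < size z'" using z(1,4) by simp
    ultimately have "size z' - size z \<le> N" using N by blast
    then show ?thesis using z(4) by simp
  qed
  then show ?thesis by (meson finite_nat_set_iff_bounded_le)
qed

text \<open>As \<open>size m \<ge> 1\<close>, the numerator of the extremal ratio is a natural
  number bounding it; if \<open>E\<close> is empty, congruent multisets are equal.\<close>

lemma bounded_length_ratio:
  obtains C where "1 \<le> C" "\<And>z z'. same_product G z z' \<Longrightarrow> size z' \<le> C * size z"
proof (cases "E = {}")
  case True
  then have "z = z'" if "same_product G z z'" for z z' using cong.sim_free_part[OF that] by simp
  then show ?thesis using that[of 1] by force
next
  case False
  then obtain m m' :: "'a set multiset" where m: "0 < size m" "size m \<le> size m'"
    "\<And>z z'. same_product G z z' \<Longrightarrow> size z' * size m \<le> size m' * size z"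
    using cong.extremal_ratio by metis
  have "size z' \<le> size m' * size z" if "same_product G z z'" for z z'
  proof -
    have "size z' * 1 \<le> size z' * size m" using m(1) by (intro mult_le_mono2) simp
    then show ?thesis using m(3)[OF that] by linarith
  qed
  then show ?thesis using that[of "size m'"] m(1,2) by simp
qed

lemma finite_elasticity: "elasticity G < \<infinity>"
proof -
  obtain C where C: "1 \<le> C" "\<And>z z'. same_product G z z' \<Longrightarrow> size z' \<le> C * size z"
    using bounded_length_ratio by blast
  have "set_elasticity (size ` factorizations G a) \<le> of_nat C" for a
  proof -
    define L where "L = size ` factorizations G a - {0}"
    show ?thesis
    proof (cases "L = {}")
      case True
      then show ?thesis using C(1) by (simp add: set_elasticity_def L_def[symmetric])
    next
      case False
      define k where "k = (LEAST k. k \<in> L)"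
      have k: "k \<in> L" using False LeastI[of "\<lambda>k. k \<in> L"] by (auto simp: k_def)
      have "l \<le> C * k" if "l \<in> L" for l
        using k that C(2) factorizations_same_product unfolding L_def by blast
      then have "(SUP l\<in>L. of_nat l :: ennreal) \<le> of_nat (C * k)"
        by (intro SUP_least) (simp only: of_nat_le_iff)
      then have "(SUP l\<in>L. of_nat l :: ennreal) / of_nat k \<le> of_nat (C * k) / of_nat k"
        by (rule divide_right_mono_ennreal)
      also have "\<dots> = of_nat C"
        using k by (simp add: L_def ennreal_mult_divide_eq)
      finally show ?thesis using False by (simp add: set_elasticity_def L_def[symmetric] k_def)
    qed
  qed
  then have "elasticity G \<le> of_nat C"
    unfolding elasticity_def length_system_eq by (auto intro: SUP_least)
  then show ?thesis by (rule le_less_trans) (simp add: of_nat_less_top)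
qed

text \<open>If \<open>u\<close> divides a product, it divides a bounded part \<open>m\<close> of the
  joined factorizations of the factors. At most \<open>size m\<close> of the factors are needed to
  cover \<open>m\<close>.\<close>

lemma finite_omega: "omega G < \<infinity>"
proof -
  obtain N where N: "\<And>u w z. same_product G (add_mset u w) z \<Longrightarrow>
      \<exists>m w'. m \<subseteq># z \<and> same_product G (add_mset u w') m \<and> size m \<le> N \<and> size w' \<le> N"
    using cong.bounded_division by metis
  have "omega_elem G u \<le> enat N" if u: "u \<in> atoms G" for u
    unfolding omega_elem_def
  proof (rule Least_le, intro allI impI)
    fix n :: nat and f
    assume f: "f \<in> {1..n} \<rightarrow> carrier G" and div: "(\<Otimes>i\<in>{1..n}. f i) \<in> u <# carrier G"
    have uc: "u \<in> carrier G" using u by (simp add: atoms_def)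
    have fc: "f i \<in> carrier G" if "i \<in> {1..n}" for i using f that by blast
    obtain h where h: "h \<in> carrier G" "(\<Otimes>i\<in>{1..n}. f i) = u \<otimes> h"
      using div by (auto simp: l_coset_def)
    obtain w where w: "w \<in> factorizations G h" using atomic[OF h(1)] mem_factorizations by blast
    have "\<forall>i\<in>{1..n}. \<exists>z. z \<in> factorizations G (f i)" using atomic[OF fc] mem_factorizations by blast
    then obtain z where z: "\<And>i. i \<in> {1..n} \<Longrightarrow> z i \<in> factorizations G (f i)" by metis
    have sum_fact: "(\<Sum>i\<in>I. z i) \<in> factorizations G (\<Otimes>i\<in>I. f i)" if I: "I \<subseteq> {1..n}" for I
    proof -
      have "finite I" using I finite_subset by blast
      then show ?thesis using I
      proof (induction I)
        case empty
        show ?case using factorizations_unit[OF Units_one_closed] by simp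
      next
        case (insert i I)
        have c: "f i \<in> carrier G" "f \<in> I \<rightarrow> carrier G" using insert.prems fc by auto
        have z': "z i \<in> factorizations G (f i)" "(\<Sum>i\<in>I. z i) \<in> factorizations G (\<Otimes>i\<in>I. f i)"
          using z insert by auto
        then have "mset_prod (reduced G) (z i + (\<Sum>i\<in>I. z i)) = \<kappa> (f i) \<otimes>\<^bsub>reduced G\<^esub> \<kappa> (\<Otimes>i\<in>I. f i)"
          using atoms_carrier by (simp only: mem_factorizations red.mset_prod_union)
        also have "\<dots> = \<kappa> (\<Otimes>i\<in>insert i I. f i)" using c insert.hyps by (simp add: mult_reduced)
        finally show ?case using z' insert.hyps by (simp add: mem_factorizations)
      qed
    qed
    have uA: "\<kappa> u \<in> atoms (reduced G)" using u uc unit_class_atom_iff by blast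
    have "mset_prod (reduced G) (add_mset (\<kappa> u) w) = \<kappa> u \<otimes>\<^bsub>reduced G\<^esub> \<kappa> h"
      using w atoms_carrier[of w] uc by (simp add: mem_factorizations red.mset_prod_add)
    then have "add_mset (\<kappa> u) w \<in> factorizations G (\<Otimes>i\<in>{1..n}. f i)"
      using uA w h uc by (simp add: mem_factorizations mult_reduced)
    then have "same_product G (add_mset (\<kappa> u) w) (\<Sum>i\<in>{1..n}. z i)"
      using sum_fact[of "{1..n}"] factorizations_same_product by blast
    then obtain m w' where m: "m \<subseteq># (\<Sum>i\<in>{1..n}. z i)" "same_product G (add_mset (\<kappa> u) w') m" "size m \<le> N"
      using N by blast
    obtain \<Omega> where \<Omega>: "\<Omega> \<subseteq> {1..n}" "card \<Omega> \<le> size m" "m \<subseteq># (\<Sum>i\<in>\<Omega>. z i)"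
      using subset_sum_mset_support[OF _ m(1)] by blast
    define v where "v = (\<Sum>i\<in>\<Omega>. z i) - m"
    have v: "(\<Sum>i\<in>\<Omega>. z i) = m + v" using \<Omega>(3) by (simp add: v_def)
    have S: "m + v \<in> factorizations G (\<Otimes>i\<in>\<Omega>. f i)" using sum_fact[OF \<Omega>(1)] v by simp
    then have vA: "set_mset v \<subseteq> atoms (reduced G)" by (simp add: mem_factorizations)
    have "same_product G (add_mset (\<kappa> u) w' + v) (m + v)" using cong.sim_add[OF m(2) vA] .
    then have "add_mset (\<kappa> u) (w' + v) \<in> factorizations G (\<Otimes>i\<in>\<Omega>. f i)"
      using S factorizations_same_product by simp
    then have fact: "set_mset (w' + v) \<subseteq> atoms (reduced G)"
      "mset_prod (reduced G) (add_mset (\<kappa> u) (w' + v)) = \<kappa> (\<Otimes>i\<in>\<Omega>. f i)"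
      by (auto simp only: mem_factorizations set_mset_add_mset_insert)
    obtain c where c: "c \<in> carrier G" "w' + v \<in> factorizations G c"
      using factorization_of_product[OF fact(1)] by blast
    have \<Omega>c: "(\<Otimes>i\<in>\<Omega>. f i) \<in> carrier G" using \<Omega>(1) fc by (intro finprod_closed) auto
    \<comment> \<open>The divisibility is obtained modulo units first; the unit \<open>e\<close>
      then moves into the cofactor.\<close>
    have "\<kappa> (\<Otimes>i\<in>\<Omega>. f i) = \<kappa> (u \<otimes> c)"
      using fact c(1,2) uc atoms_carrier[OF fact(1)]
      by (simp add: red.mset_prod_add mem_factorizations mult_reduced)
    then obtain e where e: "e \<in> Units G" "(\<Otimes>i\<in>\<Omega>. f i) = e \<otimes> (u \<otimes> c)"
      using unit_class_eq_iff[OF \<Omega>c, of "u \<otimes> c"] uc c(1) by blast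
    then have "(\<Otimes>i\<in>\<Omega>. f i) = u \<otimes> (e \<otimes> c)" using uc c(1) by (simp add: m_ac Units_closed)
    then have "(\<Otimes>i\<in>\<Omega>. f i) \<in> u <# carrier G"
      using e(1) c(1) unfolding l_coset_def by blast
    then show "\<exists>\<Omega>\<subseteq>{1..n}. enat (card \<Omega>) \<le> enat N \<and> (\<Otimes>i\<in>\<Omega>. f i) \<in> u <# carrier G"
      using \<Omega> m(3) by (intro exI[of _ \<Omega>]) simp
  qed
  then have "omega G \<le> enat N" unfolding omega_def by (rule SUP_least)
  then show ?thesis by (rule le_less_trans) simp
qed

text \<open>Inside \<open>z\<close> only the bounded part \<open>m\<close> is replaced, by
  \<open>add_mset u w'\<close>; the additional 1 in \<open>Suc N\<close> counts
  \<open>u\<close>.\<close>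

lemma finite_tame_degree: "tame_degree G < \<infinity>"
proof -
  obtain N where N: "\<And>u w z. same_product G (add_mset u w) z \<Longrightarrow>
      \<exists>m w'. m \<subseteq># z \<and> same_product G (add_mset u w') m \<and> size m \<le> N \<and> size w' \<le> N"
    using cong.bounded_division by metis
  have "tame_degree_elem G u \<le> enat (Suc N)" for u
    unfolding tame_degree_elem_def Let_def
  proof (rule Least_le, intro ballI impI)
    fix a z assume "factorizations G a \<inter> add_mset u ` factorization_monoid G \<noteq> {}"
      and z: "z \<in> factorizations G a"
    then obtain w where "add_mset u w \<in> factorizations G a" by blast
    then have "same_product G (add_mset u w) z" using z factorizations_same_product by blast
    then obtain m w' where m: "m \<subseteq># z" "same_product G (add_mset u w') m" "size m \<le> N" "size w' \<le> N"
      using N by blast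
    define r where "r = z - m"
    have zr: "z = m + r" using m(1) by (simp add: r_def)
    have "set_mset r \<subseteq> atoms (reduced G)" using z zr by (simp add: mem_factorizations)
    then have "same_product G (add_mset u w' + r) z" using cong.sim_add[OF m(2)] zr by simp
    then have fact: "add_mset u (w' + r) \<in> factorizations G a" using z factorizations_same_product by simp
    then have "w' + r \<in> factorization_monoid G"
      by (simp add: mem_factorizations factorization_monoid_def free_abelian_monoid_def)
    then have "add_mset u (w' + r) \<in> factorizations G a \<inter> add_mset u ` factorization_monoid G"
      using fact by blast
    moreover have "factorization_dist z (add_mset u (w' + r)) \<le> Suc N"
    proof -
      let ?z' = "add_mset u w' + r"
      \<comment> \<open>The unchanged part \<open>r\<close> is common to both factorizations and
        does not contribute to the distance.\<close>
      have "z - z \<inter># ?z' = m - add_mset u w'" "?z' - z \<inter># ?z' = add_mset u w' - m"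
        by (auto simp: zr multiset_eq_iff)
      then have "factorization_dist z ?z' = max (size (m - add_mset u w')) (size (add_mset u w' - m))"
        by (simp only: factorization_dist_def Let_def)
      also have "\<dots> \<le> max (size m) (size (add_mset u w'))"
        by (intro max.mono size_mset_mono diff_subset_eq_self)
      also have "\<dots> \<le> Suc N" using m(3,4) by simp
      finally show ?thesis by simp
    qed
    ultimately show "\<exists>z'\<in>factorizations G a \<inter> add_mset u ` factorization_monoid G.
        enat (factorization_dist z z') \<le> enat (Suc N)"
      by (meson enat_ord_simps(1))
  qed
  then have "tame_degree G \<le> enat (Suc N)" unfolding tame_degree_def by (intro SUP_least)
  then show ?thesis by (rule le_less_trans) simp
qed

lemma length_unions_eq:
  assumes "carrier G \<noteq> Units G"
  shows "length_unions G k = cong.colengths k"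
proof (intro equalityI subsetI)
  fix l assume "l \<in> length_unions G k"
  then obtain a z z' where "z \<in> factorizations G a" "z' \<in> factorizations G a" "size z = k" "size z' = l"
    using assms by (auto simp: length_unions_def length_system_eq)
  then show "l \<in> cong.colengths k"
    unfolding cong.colengths_def using factorizations_same_product by blast
next
  fix l assume "l \<in> cong.colengths k"
  then obtain z z' where z: "same_product G z z'" "size z = k" "size z' = l"
    unfolding cong.colengths_def by blast
  obtain a where a: "a \<in> carrier G" "z' \<in> factorizations G a"
    using factorization_of_product cong.sim_dom2[OF z(1)] by blast
  then have "z \<in> factorizations G a" using z(1) factorizations_same_product by blast
  then show "l \<in> length_unions G k" using assms a z(2,3) by (auto simp: length_unions_def length_system_eq)
qed

lemma structure_theorem: "structure_theorem_for_unions G"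
proof (cases "\<exists>w w'. same_product G w w' \<and> size w < size w'")
  case True
  then obtain w w' where w: "same_product G w w'" "size w < size w'" by blast
  \<comment> \<open>In a group the only factorization is the empty one, so two different lengths
    cannot occur.\<close>
  have "carrier G \<noteq> Units G"
  proof
    assume units: "carrier G = Units G"
    obtain a where "a \<in> carrier G" "w' \<in> factorizations G a"
      using factorization_of_product cong.sim_dom2[OF w(1)] by blast
    then have "w' = {#}" using factorizations_unit units by simp
    then show False using w(2) by simp
  qed
  moreover obtain d M where "0 < d" "\<forall>\<^sub>F k in sequentially. is_AAP d M (cong.colengths k)"
    using cong.structure_of_colengths[OF w] by blast
  ultimately show ?thesis unfolding structure_theorem_for_unions_def using length_unions_eq by auto
next
  case False
  have "length_unions G k = {k}" for k
  proof (cases "carrier G = Units G")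
    case True
    then show ?thesis by (simp add: length_unions_def)
  next
    case nontrivial: False
    have "size z = size z'" if "same_product G z z'" for z z'
      using False that cong.sim_sym by (metis nat_neq_iff)
    then have "cong.colengths k \<subseteq> {k}" by (auto simp: cong.colengths_def)
    \<comment> \<open>A non-unit supplies an atom \<open>e\<close>, and its \<open>k\<close>-fold
      repetition has length \<open>k\<close>.\<close>
    moreover have "k \<in> cong.colengths k"
    proof -
      obtain a where a: "a \<in> carrier G" "a \<notin> Units G" using nontrivial by auto
      obtain z where z: "z \<in> factorizations G a" using atomic[OF a(1)] mem_factorizations by blast
      have "z \<noteq> {#}" using z a unit_class_eq_one[OF a(1)] red.mset_prod_empty by (auto simp only: mem_factorizations)
      then obtain e where "e \<in># z" by blast
      then have "set_mset (replicate_mset k e) \<subseteq> atoms (reduced G)" using z by (auto simp: mem_factorizations)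
      from cong.sim_refl[OF this] show ?thesis
        unfolding cong.colengths_def
        by (intro CollectI exI[of _ "replicate_mset k e"]) simp
    qed
    ultimately show ?thesis using length_unions_eq[OF nontrivial] by blast
  qed
  \<comment> \<open>A singleton has no distances, so the smallest admissible constants suffice when
    all factorizations of an element have equal length.\<close>
  moreover have "is_AAP 1 0 {k}" for k
    by (rule is_AAP_finiteI[where k = k]) auto
  ultimately show ?thesis unfolding structure_theorem_for_unions_def
    by (intro exI[of _ 1] conjI exI[of _ 0]) simp_all
qed

end

theorem theorem3p6:
  fixes H :: "('a, 'b) monoid_scheme" and P T :: "'a set"
  assumes "unit_cancellative_monoid H"
    and "P \<subseteq> carrier H"
    and "\<forall>p\<in>P. Divisibility.prime H p"
    and "pairwise (\<lambda>p q. \<not> unit_assoc H p q) P"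
    and "submonoid T H"
    and "free_times H P T"
    and "finitely_generated_monoid (reduced (H\<lparr>carrier := T\<rparr>))"
  shows "(finite (distances H) \<and> elasticity H < \<infinity> \<and> omega H < \<infinity> \<and> tame_degree H < \<infinity>)
         \<and> structure_theorem_for_unions H"
proof -
  interpret unit_cancellative_monoid H by fact
  interpret free_times_finitely_generated H P T
    by (intro free_times_finitely_generated.intro free_times_finitely_generated_axioms.intro)
      (use assms in \<open>blast+\<close>)
  obtain E where "almost_free_monoid H E" using almost_free_monoid_exists by blast
  then interpret almost_free_monoid H E .
  show ?thesis
    using finite_distances finite_elasticity finite_omega finite_tame_degree structure_theorem by blast
qed

end
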